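(* Let $\varepsilon>0$ be the machine precision, and let $a\ge1$ and $1\le\tilde\delta<\delta$ be real numbers. For every real $c\ge1$ let $$\mu(c)=\left(\frac{2^{1/a}c}{a}\right)^{1/3}\left(-\frac34\log\varepsilon\right)^{2/3},$$ let $n(c)$ be an integer with $$2^{1/a}c<n(c)<2^{1/a}c+\mu(c)+1,$$ let $A_j(c)=2+2(j/c)^a$ for $j=1,\dots,n(c)$, and let $A(c)$ be the $n(c)\times n(c)$ symmetric tridiagonal matrix with diagonal entries $A_1(c),\dots,A_{n(c)}(c)$ and all sub- and superdiagonal entries equal to $1$. Suppose that, for every $c\ge1$, $\lambda(c)$ is an eigenvalue of $A(c)$ and $\delta(c)$ is a real number such that $$1<\tilde\delta<\delta(c)<\delta,\qquad \lambda(c)=4+2\left(\frac{\delta(c)}{c}\right)^{2a/(a+2)},$$ and let $X(c)=(X_1(c),\dots,X_{n(c)}(c))^T$ be the unit-norm eigenvector of $A(c)$ corresponding to $\lambda(c)$. Suppose furthermore that, for every $c\ge1$ and every $j=1,\dots,n(c)$, the quantity $A_j(c)-\lambda(c)$ is defined to relative precision $\varepsilon$. Then $$|X_1(c)|<\exp\left(-\tilde\delta\cdot D_a\right)\cdot(1+o(1)),\qquad c\to\infty,$$ where $D_a=\sqrt2\int_0^{\pi/2}(\sin\theta)^{1+2/a}\,d\theta$. Also, if $a>1$, then $$\mathrm{rel}(X_1(c))\le 620\cdot\delta^{(16-4a)/(3a+6)}\cdot c^{4a/(a+2)}\cdot\varepsilon\cdot(1+o(1)),\qquad c\to\infty,$$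 and if $a=1$, then $$\mathrm{rel}(X_1(c))\le 960\left(\frac{\delta^{4/3}}{4}+(-\log\varepsilon)^{4/3}+1\right)c^{4/3}\cdot\varepsilon\cdot(1+o(1)),\qquad c\to\infty .$$
   Context: Evaluation of $X$ from the numbers $B_j=\lambda(c)-A_j(c)$, $1\le j\le n=n(c)$: let $r$ be the index with $A_r\le\lambda<A_{r+1}$; put $x_1=1$, $x_2=B_1$, $x_{j+1}=B_jx_j-x_{j-1}$ for $2\le j\le r$; put $y_n=1$, $y_{n-1}=B_n$, $y_{j-1}=B_jy_j-y_{j+1}$ for $r+1\le j<n$; put $s=\operatorname{sgn}(x_ry_r+x_{r+1}y_{r+1})\sqrt{(x_r^2+x_{r+1}^2)/(y_r^2+y_{r+1}^2)}$, $z=(x_1,\dots,x_{r+1},s\,y_{r+2},\dots,s\,y_n)^T$, and $X=z/\|z\|$ (Euclidean norm). "$A_j-\lambda$ defined to relative precision $\varepsilon$" means that in this evaluation $B_j$ is replaced by $B_j(1+\delta_j)$ with $|\delta_j|\le\varepsilon$. For a scalar $u\ne0$ so computed, $\mathrm{rel}(u)$ is its worst-case relative error to first order (terms of order $\varepsilon^2$ ignored): $\mathrm{rel}(u)=\varepsilon\cdot\max_{|d_j|\le1}\left|\sum_jd_j\,\partial u/\partial\delta_j\right|/|u|$ evaluated at $\delta_1=\dots=\delta_n=0$. *)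

theory Defs
  imports "HOL-Analysis.Analysis" "Jordan_Normal_Form.Char_Poly"
begin

text \<open>
  Scalar sequences (\<open>A\<close>, \<open>B\<close>, \<open>x\<close>, \<open>y\<close>, \<open>z\<close>) are functions on \<^typ>\<open>nat\<close> read on the indices
  \<open>1, \<dots>, n\<close>; the matrices and vectors of the AFP library are indexed from 0, so the first
  coordinate of a vector \<open>v\<close> is \<open>vec_index v 0\<close>.
\<close>

definition diag_entry :: "real \<Rightarrow> real \<Rightarrow> nat \<Rightarrow> real" where
  "diag_entry a c j = 2 + 2 * (real j / c) powr a"

definition tridiag_mat :: "real \<Rightarrow> real \<Rightarrow> nat \<Rightarrow> real mat" where
  "tridiag_mat a c n = Matrix.mat n n (\<lambda>(i, k).
     if i = k then diag_entry a c (Suc i)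
     else if i = Suc k \<or> k = Suc i then 1 else 0)"

definition mu :: "real \<Rightarrow> real \<Rightarrow> real \<Rightarrow> real" where
  "mu eps a c = (2 powr (1/a) * c / a) powr (1/3) * (- (3/4) * ln eps) powr (2/3)"

definition D_const :: "real \<Rightarrow> real" where
  "D_const a = sqrt 2 * integral {0..pi/2} (\<lambda>t. sin t powr (1 + 2/a))"

text \<open>The value at index 0 is only there to make \<open>x\<^sub>2 = B\<^sub>1\<close> an instance of the recurrence.\<close>

fun left_seq :: "(nat \<Rightarrow> real) \<Rightarrow> nat \<Rightarrow> real" where
  "left_seq B 0 = 0"
| "left_seq B (Suc 0) = 1"
| "left_seq B (Suc (Suc j)) = B (Suc j) * left_seq B (Suc j) - left_seq B j"

text \<open>The backward recurrence for \<open>y\<close> is the forward one for the reversed sequence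
  \<open>B\<^sub>n, \<dots>, B\<^sub>1\<close>; the two lemmas below give it in its usual form.\<close>

definition right_seq :: "nat \<Rightarrow> (nat \<Rightarrow> real) \<Rightarrow> nat \<Rightarrow> real" where
  "right_seq n B j = left_seq (\<lambda>i. B (n + 1 - i)) (n + 1 - j)"

lemma right_seq_start:
  "right_seq n B n = 1"
  "n \<ge> 1 \<Longrightarrow> right_seq n B (n - 1) = B n"
  by (simp_all add: right_seq_def numeral_2_eq_2)

lemma right_seq_step:
  assumes "1 \<le> j" "j < n"
  shows "right_seq n B (j - 1) = B j * right_seq n B j - right_seq n B (j + 1)"
proof -
  obtain k where k: "n = j + Suc k"
    using assms(2) less_iff_Suc_add by auto
  obtain i where i: "j = Suc i"
    using assms(1) by (cases j) auto
  show ?thesis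
    by (simp add: right_seq_def k i numeral_3_eq_3)
qed

text \<open>The index \<open>r\<close> with \<open>A\<^sub>r \<le> \<lambda> < A\<^sub>r\<^sub>+\<^sub>1\<close>. It is unique when it exists, since the diagonal is
  strictly increasing; for \<open>\<lambda>\<close> between the first and the last diagonal entry it exists.\<close>

definition split_index :: "real \<Rightarrow> real \<Rightarrow> nat \<Rightarrow> real \<Rightarrow> nat" where
  "split_index a c n lam =
     (THE r. 1 \<le> r \<and> r < n \<and> diag_entry a c r \<le> lam \<and> lam < diag_entry a c (r + 1))"

definition glue_factor :: "nat \<Rightarrow> nat \<Rightarrow> (nat \<Rightarrow> real) \<Rightarrow> real" where
  "glue_factor n r B =
     (let x = left_seq B; y = right_seq n B in
        sgn (x r * y r + x (r + 1) * y (r + 1)) *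
        sqrt ((x r ^ 2 + x (r + 1) ^ 2) / (y r ^ 2 + y (r + 1) ^ 2)))"

definition glued_seq :: "nat \<Rightarrow> nat \<Rightarrow> (nat \<Rightarrow> real) \<Rightarrow> nat \<Rightarrow> real" where
  "glued_seq n r B j =
     (if j \<le> r + 1 then left_seq B j else glue_factor n r B * right_seq n B j)"

definition computed_vec :: "nat \<Rightarrow> nat \<Rightarrow> (nat \<Rightarrow> real) \<Rightarrow> nat \<Rightarrow> real" where
  "computed_vec n r B j = glued_seq n r B j / sqrt (\<Sum>i=1..n. (glued_seq n r B i) ^ 2)"

text \<open>First-order worst-case relative error of a scalar \<open>u\<close> depending on relative perturbations
  \<open>\<delta>\<^sub>1, \<dots>, \<delta>\<^sub>n\<close> of its inputs. The supremum is over a nonempty set bounded above and is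
  attained (at \<open>d\<^sub>j = sgn (\<partial>u/\<partial>\<delta>\<^sub>j)\<close>), so it is a maximum.\<close>

definition rel_err :: "real \<Rightarrow> nat \<Rightarrow> ((nat \<Rightarrow> real) \<Rightarrow> real) \<Rightarrow> real" where
  "rel_err eps n u =
     eps * (SUP d \<in> {d. \<forall>j\<in>{1..n}. \<bar>d j\<bar> \<le> 1}.
              \<bar>\<Sum>j=1..n. d j * deriv (\<lambda>t. u ((\<lambda>_. 0)(j := t))) 0\<bar>) / \<bar>u (\<lambda>_. 0)\<bar>"

text \<open>\<open>rel(X\<^sub>k)\<close> when each \<open>B\<^sub>j = \<lambda> - A\<^sub>j\<close> is replaced by \<open>B\<^sub>j (1 + \<delta>\<^sub>j)\<close>. The index \<open>r\<close> is
  determined by the unperturbed data; relative perturbations below 1 do not change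
  the signs of the \<open>B\<^sub>j\<close>, hence do not change \<open>r\<close>.\<close>

definition rel_computed :: "real \<Rightarrow> real \<Rightarrow> real \<Rightarrow> nat \<Rightarrow> real \<Rightarrow> nat \<Rightarrow> real" where
  "rel_computed eps a c n lam k =
     rel_err eps n (\<lambda>\<delta>. computed_vec n (split_index a c n lam)
                          (\<lambda>j. (lam - diag_entry a c j) * (1 + \<delta> j)) k)"

end

theory Submission
  imports Defs "HOL-Real_Asymp.Real_Asymp"
begin

text \<open>
  Put \<open>K = c^(a/(a+2))\<close>. The claimed relative errors are of order \<open>K\<^sup>4\<close>, whereas the true one is
  \<open>O(K^(7/2) (log c)\<^sup>2)\<close>, so the explicit constants are irrelevant. Likewise \<open>X\<^sub>1\<close> tends to 0, because
  \<open>x\<^sub>m \<ge> m / 2\<close> for all \<open>m\<close> up to a fixed multiple of \<open>K\<close>, which makes \<open>z\<close> of norm at least of order \<open>K^(3/2)\<close>.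

  The quadratic form \<open>p\<^sup>2 + q\<^sup>2 - b p q\<close> in two consecutive terms is invariant under one step of the
  recurrence with coefficient \<open>b\<close>. As the coefficients decrease from about 2 to 0, the form divided by
  \<open>2 - b\<close> decreases and the form divided by \<open>2 + b\<close> increases along every solution. This bounds the
  condition number of the transfer matrices in the energy norm, hence the derivative of the sequence
  with respect to each coefficient, relative to the sequence itself. The backward sequence \<open>y\<close> becomes,
  up to alternating signs, a forward one of the same kind, now with a linear turning point
  (exponent 1, scale \<open>c^(1/3)\<close>).
\<close>

section \<open>Energy of a three-term recurrence\<close>

text \<open>Since z_1 = 1, the computed X_1 is 1/||z||: only the sensitivity of ||z||^2 matters, and
  there the gluing factor enters squared, without its sign. The relative derivative in B_j costs
  1/(2 - b_j), which summed over j is O(K^3 log c). The remaining K^(1/2) log c is the cost of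
  passing from energies to squares. This is the delicate point: either of the two lower bounds for
  the norm, used alone, gives no better power than K^4 at a = 2, and then the explicit constants
  would matter; only their combination gives K^(1/2) for every a. A second obstacle is that the
  first coefficients exceed 2 by O(1/K^2), where the energy is indefinite; hence the truncation and
  the weights in \<open>profile\<close>. On the right, n exceeds the turning point 2^(1/a) c by
  O(c^(1/3)), which is precisely the scale of a linear turning point, so the same estimates serve
  both sides.\<close>

definition energy :: "real \<Rightarrow> real \<Rightarrow> real \<Rightarrow> real" where
  "energy b p q = p\<^sup>2 + q\<^sup>2 - b * p * q"

text \<open>With q fixed, the form is a quadratic in the other entry with vertex b q / 2, and the
  recurrence reflects p in that vertex.\<close>

lemma energy_step: "energy b q (b * q - p) = energy b p q"
  by (simp add: energy_def power2_eq_square algebra_simps)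

text \<open>The eigenvalues of the form are (2 - b)/2 and (2 + b)/2, the first being the smaller
  one. Its degeneration as b tends to 2 is the source of all later factors 1/(2 - b).\<close>

lemma energy_ge:
  assumes "0 \<le> b" shows "(2 - b) / 2 * (p\<^sup>2 + q\<^sup>2) \<le> energy b p q"
proof -
  have "energy b p q - (2 - b) / 2 * (p\<^sup>2 + q\<^sup>2) = b / 2 * (p - q)\<^sup>2"
    by (simp add: energy_def power2_eq_square field_simps)
  moreover have "\<dots> \<ge> 0" using assms by simp
  ultimately show ?thesis by linarith
qed

lemma energy_le:
  assumes "0 \<le> b" "b \<le> 2" shows "energy b p q \<le> 2 * (p\<^sup>2 + q\<^sup>2)"
proof -
  have "(1 + b / 2) * (p\<^sup>2 + q\<^sup>2) - energy b p q = b / 2 * (p + q)\<^sup>2"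
    by (simp add: energy_def power2_eq_square field_simps)
  moreover have "\<dots> \<ge> 0" using assms by simp
  moreover have "(1 + b / 2) * (p\<^sup>2 + q\<^sup>2) \<le> 2 * (p\<^sup>2 + q\<^sup>2)"
    using assms by (intro mult_right_mono) auto
  ultimately show ?thesis by linarith
qed

lemma energy_nonneg:
  assumes "0 \<le> b" "b \<le> 2" shows "0 \<le> energy b p q"
proof -
  have "0 \<le> (2 - b) / 2 * (p\<^sup>2 + q\<^sup>2)" using assms by simp
  with energy_ge[OF assms(1), of p q] show ?thesis by linarith
qed

text \<open>The quotient equals (p - q)^2 / (2 - b) + p q, where b occurs only in the first
  term.\<close>

lemma energy_mono_minus:
  assumes "b' \<le> b" "b < 2"
  shows "energy b' p q / (2 - b') \<le> energy b p q / (2 - b)"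
proof -
  have "energy b p q * (2 - b') - energy b' p q * (2 - b) = (b - b') * (p - q)\<^sup>2"
    by (simp add: energy_def power2_eq_square algebra_simps)
  moreover have "\<dots> \<ge> 0" using assms by simp
  ultimately have "energy b' p q * (2 - b) \<le> energy b p q * (2 - b')" by linarith
  then show ?thesis using assms by (simp add: divide_simps mult.commute)
qed

text \<open>Here the quotient equals (p + q)^2 / (2 + b) - p q.\<close>

lemma energy_mono_plus:
  assumes "b' \<le> b" "0 \<le> b'"
  shows "energy b p q / (2 + b) \<le> energy b' p q / (2 + b')"
proof -
  have "energy b' p q * (2 + b) - energy b p q * (2 + b') = (b - b') * (p + q)\<^sup>2"
    by (simp add: energy_def power2_eq_square algebra_simps)
  moreover have "\<dots> \<ge> 0" using assms by simp
  ultimately have "energy b p q * (2 + b') \<le> energy b' p q * (2 + b)" by linarith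
  then show ?thesis using assms by (simp add: divide_simps mult.commute)
qed

text \<open>With E the unperturbed energy, the change is e p (2 q - b p) + e^2 p^2. As (2 q - b p)^2
  = 4 E - (4 - b^2) p^2, only p loses a factor K against the square root of E, so the factor is 1 +
  O(1/K) rather than 1 + O(1).\<close>

lemma energy_kick:
  assumes b: "0 \<le> b" and K: "K \<ge> 1" "1 / K\<^sup>2 \<le> 2 - b" and e: "\<bar>e\<bar> \<le> C / K\<^sup>2" "C \<ge> 0"
  shows "energy b p (q + e * p) \<le> (1 + (3 * C + 2 * C\<^sup>2) / K) * energy b p q"
proof -
  define E where "E = energy b p q"
  have "0 < 1 / K\<^sup>2" using K by simp
  with K have b2: "b < 2" by linarith
  have E0: "E \<ge> 0" unfolding E_def using energy_nonneg b b2 by simp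
  have "1 / K\<^sup>2 / 2 * p\<^sup>2 \<le> (2 - b) / 2 * (p\<^sup>2 + q\<^sup>2)"
    using K b2 by (intro mult_mono) auto
  also have "\<dots> \<le> E" unfolding E_def by (rule energy_ge[OF b])
  finally have p: "p\<^sup>2 \<le> 2 * K\<^sup>2 * E" using K by (simp add: field_simps)
  have "(2 * q - b * p)\<^sup>2 = 4 * E - (4 - b\<^sup>2) * p\<^sup>2"
    by (simp add: E_def energy_def power2_eq_square algebra_simps)
  moreover have "b\<^sup>2 \<le> 2\<^sup>2" using b b2 by (intro power_mono) auto
  ultimately have q: "(2 * q - b * p)\<^sup>2 \<le> 4 * E"
    using mult_nonneg_nonneg[of "4 - b\<^sup>2" "p\<^sup>2"] by simp
  have "(p * (2 * q - b * p))\<^sup>2 \<le> (2 * K\<^sup>2 * E) * (4 * E)"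
    unfolding power_mult_distrib using p q E0 by (intro mult_mono) auto
  also have "\<dots> \<le> (3 * K * E)\<^sup>2"
    using mult_right_mono[of 8 9 "K\<^sup>2 * E\<^sup>2"] E0 K by (simp add: power2_eq_square algebra_simps)
  finally have pq: "\<bar>p * (2 * q - b * p)\<bar> \<le> 3 * K * E"
    using K E0 abs_le_square_iff[of "p * (2 * q - b * p)" "3 * K * E"] by simp
  have "energy b p (q + e * p) = E + e * (p * (2 * q - b * p)) + e\<^sup>2 * p\<^sup>2"
    by (simp add: E_def energy_def power2_eq_square algebra_simps)
  moreover have "e * (p * (2 * q - b * p)) \<le> (C / K\<^sup>2) * (3 * K * E)"
  proof -
    have "e * (p * (2 * q - b * p)) \<le> \<bar>e\<bar> * \<bar>p * (2 * q - b * p)\<bar>"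
      by (metis abs_ge_self abs_mult)
    also have "\<dots> \<le> (C / K\<^sup>2) * (3 * K * E)" using pq e by (intro mult_mono) auto
    finally show ?thesis .
  qed
  moreover have "(C / K\<^sup>2) * (3 * K * E) = 3 * C / K * E" using K by (simp add: power2_eq_square)
  moreover have "e\<^sup>2 * p\<^sup>2 \<le> (C / K\<^sup>2)\<^sup>2 * (2 * K\<^sup>2 * E)"
    using p e by (intro mult_mono) (auto simp: abs_le_square_iff[symmetric])
  moreover have "(C / K\<^sup>2)\<^sup>2 * (2 * K\<^sup>2 * E) = 2 * C\<^sup>2 / K\<^sup>2 * E"
    using K by (simp add: power2_eq_square field_simps)
  moreover have "2 * C\<^sup>2 / K\<^sup>2 * E \<le> 2 * C\<^sup>2 / K * E"
    using K E0 by (intro mult_right_mono divide_left_mono) (auto simp: power2_eq_square)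
  ultimately show ?thesis unfolding E_def[symmetric] by (simp add: algebra_simps add_divide_distrib)
qed

text \<open>The sequence is affine in each single coefficient, so its derivative in the relative
  perturbation of \<open>b\<^sub>j\<close> is the increment obtained by doubling \<open>b\<^sub>j\<close>.\<close>

definition resonance :: "(nat \<Rightarrow> real) \<Rightarrow> nat \<Rightarrow> nat \<Rightarrow> real" where
  "resonance b j m = left_seq (b(j := 2 * b j)) m - left_seq b m"

lemma left_seq_cong:
  assumes "\<And>i. 1 \<le> i \<Longrightarrow> i < m \<Longrightarrow> b i = b' i"
  shows "left_seq b m = left_seq b' m"
  using assms
proof (induction m rule: less_induct)
  case (less m)
  show ?case
  proof (cases "m < 2")
    case True
    then have "m = 0 \<or> m = 1" by auto
    then show ?thesis by auto
  next
    case False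
    then obtain k where k: "m = Suc (Suc k)" by (metis add_2_eq_Suc le_Suc_ex not_less)
    then show ?thesis using less.IH[of "Suc k"] less.IH[of k] less.prems by simp
  qed
qed

lemma left_seq_step: "1 \<le> m \<Longrightarrow> left_seq b (m + 1) = b m * left_seq b m - left_seq b (m - 1)"
  by (cases m) auto

lemma resonance_eq_0: "m \<le> j \<Longrightarrow> resonance b j m = 0"
  unfolding resonance_def by (simp, rule left_seq_cong) auto

text \<open>With \<open>resonance_step\<close>: beyond j the resonance solves the unperturbed
  recurrence, started from the pair (0, \<open>b j * left_seq b j\<close>), so energy estimates for
  solutions apply to it.\<close>

lemma resonance_Suc: "1 \<le> j \<Longrightarrow> resonance b j (j + 1) = b j * left_seq b j"
proof -
  assume j: "1 \<le> j"
  have "left_seq (b(j := 2 * b j)) j = left_seq b j" "left_seq (b(j := 2 * b j)) (j - 1) = left_seq b (j - 1)"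
    by (rule left_seq_cong; simp)+
  then show ?thesis using j by (simp add: resonance_def left_seq_step del: left_seq.simps One_nat_def)
qed

lemma resonance_step:
  "j < m \<Longrightarrow> resonance b j (m + 1) = b m * resonance b j m - resonance b j (m - 1)"
  using left_seq_step[of m b] left_seq_step[of m "b(j := 2 * b j)"]
  by (simp add: resonance_def algebra_simps del: left_seq.simps One_nat_def)

lemma left_seq_perturb:
  "left_seq (\<lambda>i. b i * (1 + ((\<lambda>_. 0)(j := t)) i)) m = left_seq b m + t * resonance b j m"
proof (induction m rule: less_induct)
  case (less m)
  define p where "p = (\<lambda>i. b i * (1 + ((\<lambda>_. 0)(j := t)) i))"
  show ?case
  proof (cases "m < 2")
    case True
    then have "m = 0 \<or> m = 1" by auto
    then show ?thesis by (auto simp: resonance_def)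
  next
    case False
    define l where "l = m - 1"
    have m: "m = l + 1" "1 \<le> l" "l < m" "l - 1 < m" using False by (auto simp: l_def)
    have "left_seq p m = p l * left_seq p l - left_seq p (l - 1)"
      using m left_seq_step by simp
    also have "\<dots> = p l * (left_seq b l + t * resonance b j l) - (left_seq b (l - 1) + t * resonance b j (l - 1))"
      unfolding p_def using less.IH[of l] less.IH[of "l - 1"] m by simp
    finally have *: "left_seq p m = \<dots>" .
    consider "l < j" | "l = j" | "j < l" by linarith
    then have "left_seq p m = left_seq b m + t * resonance b j m"
    proof cases
      case 1
      then show ?thesis using * m left_seq_step[of l b]
        by (simp add: p_def resonance_eq_0 del: left_seq.simps)
    next
      case 2
      then show ?thesis using * m resonance_Suc[of j b] left_seq_step[of l b]
        by (simp add: p_def resonance_eq_0 algebra_simps del: left_seq.simps)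
    next
      case 3
      then have "p l = b l" by (simp add: p_def)
      moreover have "left_seq b m = b l * left_seq b l - left_seq b (l - 1)"
        using m(1) left_seq_step[OF m(2)] by metis
      moreover have "resonance b j m = b l * resonance b j l - resonance b j (l - 1)"
        using m(1) resonance_step[OF 3] by metis
      ultimately show ?thesis unfolding * by (simp add: right_diff_distrib distrib_left)
    qed
    then show ?thesis by (simp add: p_def)
  qed
qed

lemma left_seq_uminus: "left_seq (\<lambda>i. - b i) m = (-1) ^ (m + 1) * left_seq b m"
  by (induction b m rule: left_seq.induct) (auto simp: algebra_simps)


section \<open>Sensitivity of the recurrence below a turning point\<close>

text \<open>Arithmetic-geometric mean with weight T, which avoids square roots of energies.\<close>

lemma cauchy_pair:
  fixes p q w z X T :: real
  assumes "p\<^sup>2 + q\<^sup>2 \<le> X" "w\<^sup>2 + z\<^sup>2 \<le> T\<^sup>2 * X" "0 < T"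
  shows "\<bar>p * w\<bar> + \<bar>q * z\<bar> \<le> T * X"
proof -
  have am: "2 * T * \<bar>x * y\<bar> \<le> T\<^sup>2 * x\<^sup>2 + y\<^sup>2" for x y :: real
  proof -
    have "0 \<le> (T * \<bar>x\<bar> - \<bar>y\<bar>)\<^sup>2" by simp
    also have "\<dots> = T\<^sup>2 * x\<^sup>2 + y\<^sup>2 - 2 * T * \<bar>x * y\<bar>"
      by (simp add: power2_diff power_mult_distrib abs_mult)
    finally show ?thesis by simp
  qed
  have "2 * T * (\<bar>p * w\<bar> + \<bar>q * z\<bar>) \<le> T\<^sup>2 * (p\<^sup>2 + q\<^sup>2) + (w\<^sup>2 + z\<^sup>2)"
    using am[of p w] am[of q z] by (simp add: algebra_simps)
  also have "\<dots> \<le> T\<^sup>2 * X + T\<^sup>2 * X"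
    using assms by (intro add_mono mult_left_mono) auto
  also have "\<dots> = 2 * T * (T * X)" by (simp add: power2_eq_square)
  finally show ?thesis using \<open>0 < T\<close> by simp
qed

text \<open>\<open>2 - b\<^sub>i\<close> behaves like \<open>(i / c)^al\<close> beyond the scale \<open>K\<close>, which is determined by \<open>K\<^sup>2 (K / c)^al = 1\<close>.\<close>

locale profile =
  fixes b :: "nat \<Rightarrow> real" and N :: nat and c K al kap C nu :: real
  assumes al: "1 \<le> al" and c: "1 \<le> c" and K_eq: "K = c powr (al / (al + 2))"
    and kap: "0 < kap" "kap \<le> 1" and C: "1 \<le> C" and nu: "0 < nu" "nu \<le> 1"
    and antimono: "\<And>i. 1 \<le> i \<Longrightarrow> i < N \<Longrightarrow> b (i + 1) \<le> b i"
    and last: "0 \<le> b N"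
    and first: "b 1 \<le> 2 + C / K\<^sup>2"
    and lower: "\<And>i. 1 \<le> i \<Longrightarrow> i \<le> N \<Longrightarrow> kap * (real i / c) powr al \<le> max (2 - b i) (1 / K\<^sup>2)"
    and upper: "\<And>i. 1 \<le> i \<Longrightarrow> i \<le> N \<Longrightarrow> real i \<le> K \<Longrightarrow> 2 - b i \<le> C / K\<^sup>2"
    and size: "nu * c \<le> real N"
    and large: "3 * C \<le> K" "K \<le> nu * c"
begin

text \<open>Truncating the coefficients at \<open>2 - 1 / K\<^sup>2\<close> keeps the energy definite before the turning point. The
  truncation is felt at \<open>O(K)\<close> indices only, and each of them changes the energy by a factor
  \<open>1 + O(1 / K)\<close>; the weight \<open>W\<close> absorbs these factors and stays below the constant \<open>G\<close>.\<close>

definition bh :: "nat \<Rightarrow> real" where "bh m = min (b m) (2 - 1 / K\<^sup>2)"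
definition hh :: "nat \<Rightarrow> real" where "hh m = 2 - bh m"
abbreviation u :: "nat \<Rightarrow> real" where "u \<equiv> left_seq b"
abbreviation w :: "nat \<Rightarrow> nat \<Rightarrow> real" where "w \<equiv> resonance b"
definition E :: "(nat \<Rightarrow> real) \<Rightarrow> nat \<Rightarrow> real" where "E v m = energy (bh m) (v m) (v (m + 1))"
text \<open>The constant of \<open>energy_kick\<close> for a mismatch (C + 1) / K^2, the most by
  which truncation can change a coefficient.\<close>

definition kick :: real where "kick = 3 * (C + 1) + 2 * (C + 1)\<^sup>2"
definition ell :: real where "ell = kap powr (- 1 / al)"
definition W :: "nat \<Rightarrow> real" where "W m = exp (kick / K * min (real m) (ell * K))"
definition G :: real where "G = exp (kick * ell)"
definition H :: real where "H = (\<Sum>i=1..N. 1 / real i)"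
text \<open>On the left N = r, and \<open>P\<close> is the squared norm of x_1, ..., x_(r+1);
  \<open>Q\<close> belongs to the pair at which the two sequences are glued.\<close>

definition P :: real where "P = (\<Sum>m=1..N + 1. (u m)\<^sup>2)"
definition Q :: real where "Q = (u N)\<^sup>2 + (u (N + 1))\<^sup>2"

section \<open>Scale relations, bounds for the truncated coefficients and the weights\<close>

lemma K1: "1 \<le> K" using C large by simp

lemma c0: "0 < c" using c by simp

lemma N1: "1 \<le> N"
proof -
  have "0 < nu * c" using nu c by simp
  then show ?thesis using size by linarith
qed

lemma c_eq: "c = K powr (1 + 2 / al)"
proof -
  have "K powr (1 + 2 / al) = c powr (al / (al + 2) * (1 + 2 / al))"
    by (simp add: K_eq powr_powr)
  also have "al / (al + 2) * (1 + 2 / al) = 1"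
  proof -
    have "1 + 2 / al = (al + 2) / al" using al by (simp add: field_simps)
    then show ?thesis using al by simp
  qed
  finally show ?thesis using c by simp
qed

lemma cK: "(c / K) powr al = K\<^sup>2"
proof -
  have "c / K = K powr (2 / al)"
    using K1 by (subst c_eq) (simp add: powr_add)
  then show ?thesis using al K1 by (simp add: powr_powr)
qed

lemma b_le:
  assumes "1 \<le> i" "i \<le> j" "j \<le> N" shows "b j \<le> b i"
  using assms(2,3)
proof (induction j rule: dec_induct)
  case (step j)
  then have "b (j + 1) \<le> b j" using assms(1) by (intro antimono) auto
  then show ?case using step by simp
qed simp

lemma b_bounds:
  assumes "1 \<le> i" "i \<le> N" shows "0 \<le> b i" "b i \<le> 3 * C" "b i \<le> 2 + C / K\<^sup>2"
proof -
  show "0 \<le> b i" using b_le[of i N] assms last by simp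
  show *: "b i \<le> 2 + C / K\<^sup>2" using b_le[of 1 i] assms first by simp
  have "C / K\<^sup>2 \<le> C / 1" using K1 C by (intro divide_left_mono) auto
  then show "b i \<le> 3 * C" using * C by simp
qed

lemma invK: "0 < 1 / K\<^sup>2" "1 / K\<^sup>2 \<le> 1"
  using K1 by (auto simp: divide_simps)

lemma bh_bounds:
  assumes "1 \<le> i" "i \<le> N" shows "0 \<le> bh i" "bh i < 2" "1 / K\<^sup>2 \<le> hh i" "0 < hh i" "hh i \<le> 2"
    "1 / K\<^sup>2 \<le> 2 - bh i"
proof -
  show "0 \<le> bh i" using b_bounds(1)[OF assms] order_trans[OF invK(2), of 2] by (simp add: bh_def)
  then show "hh i \<le> 2" by (simp add: hh_def)
  show "1 / K\<^sup>2 \<le> 2 - bh i" by (simp add: bh_def)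
  then show "1 / K\<^sup>2 \<le> hh i" by (simp add: hh_def)
  then show "0 < hh i" using invK(1) by linarith
  then show "bh i < 2" by (simp add: hh_def)
qed

lemma bh_le:
  assumes "1 \<le> i" "i \<le> j" "j \<le> N" shows "bh j \<le> bh i"
  using b_le[OF assms] by (simp add: bh_def)

text \<open>\<open>hh\<close> is exactly the maximum on the right of \<open>lower\<close>.\<close>

lemma hh_ge: "1 \<le> i \<Longrightarrow> i \<le> N \<Longrightarrow> kap * (real i / c) powr al \<le> hh i"
  using lower[of i] by (simp add: hh_def bh_def max_def min_def split: if_splits)

lemma kick_pos: "0 < kick" using C by (simp add: kick_def add_pos_nonneg)

lemma ell_pos: "0 < ell" using kap by (simp add: ell_def)

lemma W_mono: "m \<le> m' \<Longrightarrow> W m \<le> W m'"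
  unfolding W_def using kick_pos K1 by (intro exp_mono mult_left_mono) auto

lemma W_bounds: "1 \<le> W m" "W m \<le> G"
proof -
  show "1 \<le> W m" using kick_pos ell_pos K1 by (simp add: W_def)
  have "kick / K * min (real m) (ell * K) \<le> kick / K * (ell * K)"
    using kick_pos K1 by (intro mult_left_mono) auto
  then show "W m \<le> G" using K1 by (simp add: W_def G_def)
qed

lemma G1: "1 \<le> G" using W_bounds[of 0] by linarith

text \<open>Where truncation acts, \<open>hh m\<close> equals 1 / K^2, and \<open>cK\<close> turns
  the lower bound for it into a bound on (m / K)^al.\<close>

lemma kick_range:
  assumes "1 \<le> m" "m \<le> N" "bh m \<noteq> b m" shows "real m \<le> ell * K"
proof -
  have "hh m = 1 / K\<^sup>2" using assms(3) by (auto simp: hh_def bh_def min_def split: if_splits)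
  then have *: "kap * (real m / c) powr al \<le> 1 / K\<^sup>2" using hh_ge[OF assms(1,2)] by simp
  have "(real m / K) powr al = (real m / c) powr al * (c / K) powr al"
    using c0 K1 by (simp add: powr_mult[symmetric])
  also have "\<dots> \<le> 1 / kap" using * kap K1 by (simp add: cK field_simps)
  finally have "((real m / K) powr al) powr (1 / al) \<le> (1 / kap) powr (1 / al)"
    using al by (intro powr_mono2) auto
  then have "real m / K \<le> ell"
    using al K1 kap by (simp add: powr_powr ell_def powr_minus powr_divide inverse_eq_divide)
  then show ?thesis using K1 by (simp add: field_simps)
qed

lemma W_step:
  assumes "1 \<le> m + 1" "m + 1 \<le> N" "bh (m + 1) \<noteq> b (m + 1)"
  shows "(1 + kick / K) * W m \<le> W (m + 1)"
proof -
  have "real (m + 1) \<le> ell * K" by (rule kick_range[OF assms])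
  then have "W (m + 1) = exp (kick / K) * W m"
    by (simp add: W_def exp_add[symmetric] algebra_simps add_divide_distrib)
  moreover have "1 + kick / K \<le> exp (kick / K)" by simp
  ultimately show ?thesis using W_bounds(1)[of m] by (simp add: mult_right_mono)
qed

section \<open>Transport of the weighted energy along solutions\<close>

lemma E_nonneg: "1 \<le> m \<Longrightarrow> m \<le> N \<Longrightarrow> 0 \<le> E v m"
  unfolding E_def using bh_bounds by (intro energy_nonneg) (auto simp: less_imp_le)

text \<open>One step is split in three: lowering the coefficient from \<open>bh m\<close> to
  \<open>bh (m + 1)\<close> at a fixed pair, which is monotone; the exact recurrence with
  \<open>bh (m + 1)\<close>, which preserves the form; and the kick by the mismatch e, absorbed by
  \<open>W\<close>.\<close>

lemma E_step:
  assumes m: "1 \<le> m" "m < N" and v: "v (m + 2) = b (m + 1) * v (m + 1) - v m"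
  shows "E v (m + 1) / (hh (m + 1) * W (m + 1)) \<le> E v m / (hh m * W m)" (is ?up)
    and "E v m * W m / (2 + bh m) \<le> E v (m + 1) * W (m + 1) / (2 + bh (m + 1))" (is ?down)
proof -
  define be p q e where "be = bh (m + 1)" and "p = v (m + 1)" and "q = be * p - v m"
    and "e = b (m + 1) - be"
  define F where "F = energy be p q"
  have F: "F = energy be (v m) p" by (simp add: F_def q_def energy_step)
  have E': "E v (m + 1) = energy be p (q + e * p)"
    using v by (simp add: E_def be_def p_def q_def e_def left_diff_distrib)
  have m': "1 \<le> m + 1" "m + 1 \<le> N" using m by auto
  note bd = bh_bounds[OF m'] bh_bounds[of m]
  have F0: "0 \<le> F" "0 \<le> E v (m + 1)"
    using bd E_nonneg[OF m'] unfolding F_def be_def by (auto intro!: energy_nonneg)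
  have e: "\<bar>e\<bar> \<le> (C + 1) / K\<^sup>2"
    using b_bounds[OF m'] invK C
    by (auto simp: e_def be_def bh_def min_def add_divide_distrib)
  have W: "0 < W m" "0 < W (m + 1)" "W m \<le> W (m + 1)"
    using W_bounds(1)[of m] W_bounds(1)[of "m + 1"] W_mono[of m "m + 1"] by auto
  have kick: "W m * E v (m + 1) \<le> W (m + 1) * F" "W m * F \<le> W (m + 1) * E v (m + 1)"
  proof -
    have "W m * E v (m + 1) \<le> W (m + 1) * F \<and> W m * F \<le> W (m + 1) * E v (m + 1)"
    proof (cases "e = 0")
      case True
      then have "E v (m + 1) = F" unfolding E' F_def by simp
      then show ?thesis using F0 W by (simp add: mult_right_mono)
    next
      case False
      then have ws: "(1 + kick / K) * W m \<le> W (m + 1)"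
        by (intro W_step m') (auto simp: e_def be_def)
      have "E v (m + 1) \<le> (1 + kick / K) * F"
        unfolding E' F_def kick_def using energy_kick[OF _ K1 _ e] bd C by (simp add: be_def)
      \<comment> \<open>The kick with -e undoes the kick with e, which gives the opposite
        estimate.\<close>
      moreover have "F \<le> (1 + kick / K) * E v (m + 1)"
        unfolding E' F_def kick_def
        using energy_kick[of be K "-e" "C + 1" p "q + e * p"] K1 e bd C by (simp add: be_def)
      ultimately have "W m * E v (m + 1) \<le> ((1 + kick / K) * W m) * F"
          "W m * F \<le> ((1 + kick / K) * W m) * E v (m + 1)"
        using W mult_left_mono[of "E v (m + 1)" _ "W m"] mult_left_mono[of F _ "W m"]
        by (auto simp: mult.assoc mult.left_commute)
      then show ?thesis using ws F0 by (meson mult_right_mono order_trans)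
    qed
    then show "W m * E v (m + 1) \<le> W (m + 1) * F" "W m * F \<le> W (m + 1) * E v (m + 1)" by auto
  qed
  have le: "be \<le> bh m" unfolding be_def using m by (intro bh_le) auto
  have up: "F / hh (m + 1) \<le> E v m / hh m"
    using energy_mono_minus[OF le, of "v m" p] bd m by (simp add: F E_def hh_def be_def p_def)
  have down: "E v m / (2 + bh m) \<le> F / (2 + bh (m + 1))"
    using energy_mono_plus[OF le, of "v m" p] bd m by (simp add: F E_def be_def p_def)
  have "E v (m + 1) / W (m + 1) \<le> F / W m" using kick W by (simp add: field_simps)
  then have "E v (m + 1) / W (m + 1) / hh (m + 1) \<le> F / W m / hh (m + 1)"
    using bd by (intro divide_right_mono) auto
  moreover have "F / hh (m + 1) / W m \<le> E v m / hh m / W m"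
    using up W by (intro divide_right_mono) auto
  ultimately show ?up by (simp add: mult.commute)
  have "E v m / (2 + bh m) * W m \<le> F / (2 + bh (m + 1)) * W m"
    using down W by (intro mult_right_mono) auto
  also have "\<dots> = (W m * F) / (2 + bh (m + 1))" by simp
  also have "\<dots> \<le> (W (m + 1) * E v (m + 1)) / (2 + bh (m + 1))"
    using kick bd by (intro divide_right_mono) auto
  finally show ?down by (simp add: mult.commute)
qed

text \<open>Telescopes \<open>E_step\<close>. The recurrence is required only beyond j, so that v
  may be the resonance \<open>w j\<close> as well as \<open>u\<close>.\<close>

lemma E_compare:
  assumes j: "1 \<le> j" "j \<le> m" "m \<le> N"
    and v: "\<And>i. j < i \<Longrightarrow> i \<le> N \<Longrightarrow> v (i + 1) = b i * v i - v (i - 1)"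
  shows "E v m \<le> G * (hh m / hh j) * E v j" and "E v j \<le> 2 * G * E v m"
proof -
  have "E v m / (hh m * W m) \<le> E v j / (hh j * W j) \<and> E v j * W j / (2 + bh j) \<le> E v m * W m / (2 + bh m)"
    using j(2,3)
  proof (induction m rule: dec_induct)
    case (step i)
    have "E v (i + 1) / (hh (i + 1) * W (i + 1)) \<le> E v i / (hh i * W i)"
      "E v i * W i / (2 + bh i) \<le> E v (i + 1) * W (i + 1) / (2 + bh (i + 1))"
      using step j(1) v[of "i + 1"] E_step[of i v] by auto
    with step show ?case by auto
  qed simp
  then have A: "E v m / (hh m * W m) \<le> E v j / (hh j * W j)"
    and B: "E v j * W j / (2 + bh j) \<le> E v m * W m / (2 + bh m)" by auto
  have jN: "j \<le> N" "1 \<le> m" using j by auto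
  note bd = bh_bounds[OF j(1) jN(1)] bh_bounds[OF jN(2) j(3)]
  note Ej = E_nonneg[OF j(1) jN(1), of v] and Em = E_nonneg[OF jN(2) j(3), of v]
  have Wp: "0 < W i" for i using W_bounds(1)[of i] by linarith
  have "E v m \<le> hh m * W m * (E v j / (hh j * W j))"
    using A bd Wp by (simp add: pos_divide_le_eq mult.commute)
  also have "\<dots> = (W m / W j) * (hh m / hh j) * E v j" by (simp add: mult_ac)
  also have "\<dots> \<le> G * (hh m / hh j) * E v j"
  proof (intro mult_right_mono)
    have "W m / W j \<le> W m / 1" using W_bounds(1) Wp by (intro divide_left_mono) (auto simp: less_imp_le)
    then show "W m / W j \<le> G" using W_bounds(2)[of m] by simp
  qed (use bd Ej in auto)
  finally show "E v m \<le> G * (hh m / hh j) * E v j" .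
  have "E v j / 4 \<le> E v j * W j / (2 + bh j)"
  proof (rule frac_le)
    show "E v j \<le> E v j * W j" using Ej W_bounds(1)[of j] by (simp add: mult_le_cancel_left1)
  qed (use Ej Wp[of j] bd in auto)
  also note B
  also have "E v m * W m / (2 + bh m) \<le> E v m * G / 2"
    using Em W_bounds(2)[of m] Wp[of m] bd G1 by (intro frac_le mult_mono) auto
  finally show "E v j \<le> 2 * G * E v m" by (simp add: mult_ac)
qed


lemma E_leq: "1 \<le> m \<Longrightarrow> m \<le> N \<Longrightarrow> E v m \<le> 2 * ((v m)\<^sup>2 + (v (m + 1))\<^sup>2)"
  unfolding E_def using bh_bounds[of m] by (intro energy_le) auto

lemma E_geq: "1 \<le> m \<Longrightarrow> m \<le> N \<Longrightarrow> (v m)\<^sup>2 + (v (m + 1))\<^sup>2 \<le> 2 * E v m / hh m"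
  using energy_ge[of "bh m" "v m" "v (m + 1)"] bh_bounds[of m]
  by (simp add: E_def hh_def field_simps)

lemma E_u_compare:
  assumes "1 \<le> j" "j \<le> m" "m \<le> N"
  shows "E u m \<le> G * (hh m / hh j) * E u j" and "E u j \<le> 2 * G * E u m"
  using E_compare[OF assms, of u] left_seq_step by (auto simp del: left_seq.simps)

section \<open>Sensitivity to a single coefficient\<close>

text \<open>The resonance starts with energy at most 9 C^2 (u j)^2, and (u j)^2 is at most 4 G (E u
  m) / (hh j). Transport of the resonance to m costs a second factor 1 / (hh j). Its energy is thus
  at most T^2 times that of u, and after taking roots a single 1 / (hh j) remains.\<close>

lemma sensitivity:
  assumes j: "1 \<le> j" "j \<le> m" "m \<le> N"
  shows "\<bar>u m * w j m\<bar> + \<bar>u (m + 1) * w j (m + 1)\<bar> \<le> 18 * G * C * (E u m / hh m) / hh j"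
proof -
  have jN: "j \<le> N" "1 \<le> m" using j by auto
  note bd = bh_bounds[OF j(1) jN(1)] bh_bounds[OF jN(2) j(3)]
  note Ej = E_nonneg[OF j(1) jN(1), of u] and Em = E_nonneg[OF jN(2) j(3), of u]
  \<comment> \<open>9 is the square root of 72, rounded up; 72 = 2 * 9 * 4 collects the constants
    below.\<close>
  define T where "T = 9 * G * C / hh j"
  have T: "0 < T" using G1 C bd by (simp add: T_def)
  have "(u j)\<^sup>2 \<le> 2 * E u j / hh j"
    using E_geq[OF j(1) jN(1), of u] zero_le_power2[of "u (j + 1)"] by linarith
  also have "\<dots> \<le> 2 * (2 * G * E u m) / hh j"
    using E_u_compare(2)[OF j] bd by (intro divide_right_mono mult_left_mono) auto
  finally have uj: "(u j)\<^sup>2 \<le> 4 * G * E u m / hh j" by simp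
  have bj: "(b j)\<^sup>2 \<le> (3 * C)\<^sup>2" using b_bounds[OF j(1) jN(1)] by (intro power_mono)
  have Ew: "E (w j) j = (b j * u j)\<^sup>2"
    using resonance_Suc[OF j(1), of b] by (simp add: E_def energy_def resonance_eq_0)
  have "E (w j) m \<le> G * (hh m / hh j) * E (w j) j"
    using resonance_step by (intro E_compare[OF j]) auto
  also have "\<dots> \<le> G * (2 / hh j) * ((3 * C)\<^sup>2 * (4 * G * E u m / hh j))"
    unfolding Ew power_mult_distrib using bd G1 uj bj
    by (intro mult_mono divide_right_mono mult_nonneg_nonneg) auto
  also have "\<dots> = 72 * G\<^sup>2 * C\<^sup>2 / (hh j)\<^sup>2 * E u m"
    by (simp add: power2_eq_square)
  also have "\<dots> \<le> T\<^sup>2 * E u m"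
    unfolding T_def power_divide power_mult_distrib
    using Em by (intro mult_right_mono divide_right_mono) auto
  finally have Em': "E (w j) m \<le> T\<^sup>2 * E u m" .
  have "(w j m)\<^sup>2 + (w j (m + 1))\<^sup>2 \<le> 2 * E (w j) m / hh m" by (rule E_geq[OF jN(2) j(3)])
  also have "\<dots> \<le> 2 * (T\<^sup>2 * E u m) / hh m"
    using Em' bd by (intro divide_right_mono mult_left_mono) auto
  also have "\<dots> = T\<^sup>2 * (2 * E u m / hh m)" by simp
  finally have "\<bar>u m * w j m\<bar> + \<bar>u (m + 1) * w j (m + 1)\<bar> \<le> T * (2 * E u m / hh m)"
    by (intro cauchy_pair[OF E_geq[OF jN(2) j(3)] _ T])
  then show ?thesis by (simp add: T_def mult_ac)
qed

lemma H1: "1 \<le> H"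
proof -
  have "1 / real 1 \<le> (\<Sum>i=1..N. 1 / real i)"
    using N1 by (intro member_le_sum) auto
  then show ?thesis by (simp add: H_def)
qed

text \<open>Up to K each term is at most K^2, hence at most K^3 / j; beyond K, al >= 1 gives (j /
  K)^al >= j / K, so \<open>hh j\<close> is at least kap j / K^3.\<close>

lemma sum_inverse_hh: "(\<Sum>j=1..N. 1 / hh j) \<le> K ^ 3 * H / kap"
proof -
  have "1 / hh j \<le> K ^ 3 / kap * (1 / real j)" if j: "j \<in> {1..N}" for j
  proof (cases "real j \<le> K")
    case True
    have "1 / hh j \<le> K\<^sup>2"
      using bh_bounds[of j] j K1 by (simp add: field_simps)
    also have "\<dots> \<le> K ^ 3 * (1 / real j)"
      using True j K1 by (simp add: field_simps power3_eq_cube power2_eq_square)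
    also have "\<dots> \<le> K ^ 3 * (1 / real j) / kap"
    proof -
      have "K ^ 3 * (1 / real j) / 1 \<le> K ^ 3 * (1 / real j) / kap"
        using kap K1 by (intro divide_left_mono) auto
      then show ?thesis by simp
    qed
    finally show ?thesis by (simp add: mult.commute)
  next
    case False
    have "K\<^sup>2 * (real j / c) powr al = (real j / K) powr al"
      using c0 K1 by (simp add: cK[symmetric] powr_mult[symmetric])
    also have "\<dots> \<ge> (real j / K) powr 1"
      using False K1 al by (intro powr_mono) auto
    finally have "real j / K \<le> K\<^sup>2 * (real j / c) powr al" using K1 by simp
    then have "kap * (real j / K) \<le> K\<^sup>2 * (kap * (real j / c) powr al)"
      using kap mult_left_mono[of "real j / K" _ kap] by (simp add: mult.left_commute)
    also have "\<dots> \<le> K\<^sup>2 * hh j" using hh_ge[of j] j by (intro mult_left_mono) auto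
    finally have "kap * real j \<le> K ^ 3 * hh j"
      using K1 by (simp add: field_simps power3_eq_cube power2_eq_square)
    then show ?thesis using bh_bounds[of j] j kap by (simp add: field_simps)
  qed
  then have "(\<Sum>j=1..N. 1 / hh j) \<le> (\<Sum>j=1..N. K ^ 3 / kap * (1 / real j))"
    by (rule sum_mono)
  also have "\<dots> = K ^ 3 * H / kap" unfolding H_def sum_distrib_left[symmetric] by simp
  finally show ?thesis .
qed

section \<open>Lower bounds for the squared norm\<close>

text \<open>The second difference of u is -(2 - b) u, here of size at most (C / K^2) (3/2) (K / (3
  C)) = 1 / (2 K), so the increments stay between 1/2 and 3/2.\<close>

lemma initial_growth:
  assumes "real m \<le> K / (3 * C)" "m \<le> N"
  shows "\<bar>u (m + 1) - u m - 1\<bar> \<le> real m / (2 * K) \<and> real m / 2 \<le> u m \<and> u m \<le> 3 / 2 * real m"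
  using assms
proof (induction m)
  case (Suc m)
  have "K / (3 * C) \<le> K / 1" using C K1 by (intro divide_left_mono) auto
  then have mK: "real (Suc m) \<le> K" using Suc.prems by simp
  have IH: "\<bar>u (m + 1) - u m - 1\<bar> \<le> real m / (2 * K)" "real m / 2 \<le> u m" "u m \<le> 3 / 2 * real m"
    using Suc by auto
  have "real m / (2 * K) \<le> 1 / 2" using mK K1 by (simp add: field_simps)
  then have um: "real (Suc m) / 2 \<le> u (Suc m)" "u (Suc m) \<le> 3 / 2 * real (Suc m)"
    using IH by (auto simp: field_simps)
  have h: "\<bar>2 - b (Suc m)\<bar> \<le> C / K\<^sup>2"
    using upper[of "Suc m"] b_bounds[of "Suc m"] mK Suc.prems by auto
  have "u (Suc m + 1) - u (Suc m) - 1 = (u (m + 1) - u m - 1) - (2 - b (Suc m)) * u (Suc m)"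
    by (simp add: algebra_simps)
  moreover have "\<bar>(2 - b (Suc m)) * u (Suc m)\<bar> \<le> C / K\<^sup>2 * (3 / 2 * (K / (3 * C)))"
    unfolding abs_mult using h um Suc.prems K1 C by (intro mult_mono) auto
  moreover have "C / K\<^sup>2 * (3 / 2 * (K / (3 * C))) = 1 / (2 * K)"
    using K1 C by (simp add: power2_eq_square)
  moreover have "real m / (2 * K) + 1 / (2 * K) = real (Suc m) / (2 * K)"
    by (simp add: add_divide_distrib)
  ultimately have "\<bar>u (Suc m + 1) - u (Suc m) - 1\<bar> \<le> real (Suc m) / (2 * K)"
    using IH(1) by linarith
  with um show ?case by blast
qed (use K1 in simp)

text \<open>By \<open>large\<close> the floor M is at least 1, so rounding loses at most a factor 2.
  The constant is 6^3 times 12, the 12 coming from the sum of (m / 2)^2.\<close>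

lemma P_ge_cube: "K ^ 3 \<le> 2592 * C ^ 3 * P"
proof -
  define M where "M = nat \<lfloor>K / (3 * C)\<rfloor>"
  have KC: "1 \<le> K / (3 * C)" using large C by (simp add: field_simps)
  have M: "real M \<le> K / (3 * C)" "K / (3 * C) < real M + 1" using KC by (auto simp: M_def)
  have "K / (3 * C) \<le> K / 1" using C K1 by (intro divide_left_mono) auto
  then have MN: "M \<le> N" using M large size by simp
  have "real M ^ 3 / 3 \<le> (\<Sum>m=1..M. (real m)\<^sup>2)"
  proof (induction M)
    case (Suc M)
    then show ?case by (simp add: power3_eq_cube power2_eq_square field_simps)
  qed simp
  also have "\<dots> \<le> (\<Sum>m=1..M. 4 * (u m)\<^sup>2)"
  proof (rule sum_mono)
    fix m assume m: "m \<in> {1..M}"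
    then have "real m / 2 \<le> u m" using initial_growth[of m] M MN by auto
    then have "(real m / 2)\<^sup>2 \<le> (u m)\<^sup>2" by (intro power_mono) auto
    then show "(real m)\<^sup>2 \<le> 4 * (u m)\<^sup>2" by (simp add: power2_eq_square)
  qed
  also have "\<dots> \<le> (\<Sum>m=1..N + 1. 4 * (u m)\<^sup>2)"
    using MN by (intro sum_mono2) auto
  also have "\<dots> = 4 * P" unfolding P_def sum_distrib_left ..
  finally have "real M ^ 3 \<le> 12 * P" by simp
  moreover have "K ^ 3 \<le> (6 * C * real M) ^ 3"
  proof (rule power_mono)
    have "1 \<le> M" using KC by (simp add: M_def le_nat_iff le_floor_iff)
    then have "K / (3 * C) \<le> 2 * real M" using M(2) by linarith
    then show "K \<le> 6 * C * real M" using C by (simp add: field_simps)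
  qed (use K1 in simp)
  ultimately have "K ^ 3 \<le> 216 * C ^ 3 * real M ^ 3" by (simp add: power_mult_distrib)
  also have "\<dots> \<le> 216 * C ^ 3 * (12 * P)"
    using \<open>real M ^ 3 \<le> 12 * P\<close> C by (intro mult_left_mono) auto
  finally show ?thesis by simp
qed

text \<open>Product of nu / 2 (number of indices in the upper half, in units of c), kap (nu / 2)^al
  (lower bound for \<open>hh\<close> there), 1 / (2 G) (transport of energy) and 1/4
  (\<open>sum_E_le\<close>).\<close>

definition spread :: real where "spread = nu * kap * (nu / 2) powr al / (16 * G)"

lemma spread_pos: "0 < spread" using nu kap G1 by (simp add: spread_def)

lemma sum_E_le: "(\<Sum>m=1..N. E u m) \<le> 4 * P"
proof -
  have "(\<Sum>m=1..N. E u m) \<le> (\<Sum>m=1..N. 2 * ((u m)\<^sup>2 + (u (m + 1))\<^sup>2))"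
    by (intro sum_mono E_leq) auto
  also have "\<dots> = 2 * (\<Sum>m=1..N. (u m)\<^sup>2) + 2 * (\<Sum>m=1..N. (u (m + 1))\<^sup>2)"
    by (simp add: sum.distrib sum_distrib_left)
  also have "(\<Sum>m=1..N. (u (m + 1))\<^sup>2) = (\<Sum>m=2..N + 1. (u m)\<^sup>2)"
    by (rule sum.reindex_bij_witness[of _ "\<lambda>m. m - 1" "\<lambda>m. m + 1"]) auto
  also have "(\<Sum>m=2..N + 1. (u m)\<^sup>2) \<le> P" unfolding P_def by (intro sum_mono2) auto
  also have "(\<Sum>m=1..N. (u m)\<^sup>2) \<le> P" unfolding P_def by (intro sum_mono2) auto
  finally show ?thesis by simp
qed

text \<open>On the upper half of the indices \<open>hh\<close> is bounded below by a constant, so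
  each energy there is at least a fixed multiple of the last one; there are at least nu c / 2 such
  indices.\<close>

lemma P_ge_spread: "spread * c * E u N \<le> P"
proof -
  define z where "z = E u N * (kap * (nu / 2) powr al) / (2 * G)"
  have EN: "0 \<le> E u N" using N1 E_nonneg by simp
  have z0: "0 \<le> z" using EN kap G1 by (simp add: z_def)
  have "z \<le> E u m" if m: "m \<in> {N - N div 2..N}" for m
  proof -
    have m': "1 \<le> m" "m \<le> N" "real N / 2 \<le> real m" using m N1 by auto
    have "nu / 2 \<le> real m / c" using m' size c0 by (simp add: field_simps)
    then have "kap * (nu / 2) powr al \<le> kap * (real m / c) powr al"
      using kap nu al by (intro mult_left_mono powr_mono2) auto
    also have "\<dots> \<le> hh m" using hh_ge m' by simp
    finally have hm: "kap * (nu / 2) powr al \<le> hh m" .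
    have "E u N \<le> G * (hh N / hh m) * E u m" using E_u_compare(1)[OF m'(1,2)] by simp
    also have "\<dots> \<le> G * (2 / hh m) * E u m"
      using E_nonneg[OF m'(1,2)] G1 bh_bounds(5)[OF N1] bh_bounds(4)[OF m'(1,2)]
      by (intro mult_right_mono mult_left_mono divide_right_mono) auto
    finally have "E u N * hh m \<le> 2 * G * E u m"
      using bh_bounds(4)[OF m'(1,2)] by (simp add: field_simps)
    moreover have "E u N * (kap * (nu / 2) powr al) \<le> E u N * hh m"
      using hm EN by (rule mult_left_mono)
    ultimately show ?thesis using G1 by (simp add: z_def field_simps)
  qed
  then have "real (card {N - N div 2..N}) * z \<le> (\<Sum>m=N - N div 2..N. E u m)"
    by (intro sum_bounded_below[where K = z, unfolded of_nat_id]) auto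
  also have "\<dots> \<le> (\<Sum>m=1..N. E u m)"
    using N1 E_nonneg by (intro sum_mono2) auto
  also have "\<dots> \<le> 4 * P" by (rule sum_E_le)
  finally have "real (card {N - N div 2..N}) * z \<le> 4 * P" .
  moreover have "nu * c / 2 * z \<le> real (card {N - N div 2..N}) * z"
  proof (intro mult_right_mono z0)
    have "real N / 2 \<le> real (N div 2 + 1)" by linarith
    then show "nu * c / 2 \<le> real (card {N - N div 2..N})" using size by simp
  qed
  ultimately have "nu * c / 2 * z \<le> 4 * P" by linarith
  then show ?thesis by (simp add: spread_def z_def field_simps)
qed

section \<open>Amplitudes relative to the norm, and summed sensitivities\<close>

text \<open>Adds the constants of the two regimes of \<open>amplitude_le\<close>; 18144 is 7 times
  2592, from \<open>E_1_le\<close> and \<open>P_ge_cube\<close>.\<close>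

definition flat :: real where "flat = 18144 * C ^ 5 * G + 2 * G / (spread * kap)"

lemma flat_pos: "0 < flat" using G1 C spread_pos kap by (simp add: flat_def add_pos_pos)

lemma P_pos: "0 < P"
proof -
  have "(u 1)\<^sup>2 \<le> P" unfolding P_def by (intro member_le_sum) auto
  then show ?thesis by simp
qed

lemma E_1_le: "E u 1 \<le> 7 * C\<^sup>2"
proof -
  have "b 1 * (b 1 - bh 1) \<le> 3 * C * (2 * C)"
  proof (intro mult_mono)
    have "C / K\<^sup>2 \<le> C / 1" using K1 C by (intro divide_left_mono) auto
    then show "b 1 - bh 1 \<le> 2 * C"
      using b_bounds(3)[of 1] N1 invK(2) C unfolding bh_def min_def by (auto split: if_splits)
  qed (use b_bounds[of 1] N1 C in \<open>auto simp: bh_def\<close>)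
  moreover have "E u 1 = 1 + b 1 * (b 1 - bh 1)"
    by (simp add: E_def energy_def numeral_2_eq_2 power2_eq_square algebra_simps)
  moreover have "1 \<le> C\<^sup>2" using C by simp
  ultimately show ?thesis by (simp add: power2_eq_square)
qed

text \<open>The exponent on the left falls short of 1/2 by (al - 2)^2 / (2 al). So the power K^(1/2)
  serves all al, with equality at al = 2; this is where the final exponent 7/2 comes from.\<close>

lemma c_K_powr: "(c / K powr (3 / 2)) powr (al - 1) \<le> K powr (1 / 2)"
proof -
  have "c / K powr (3 / 2) = K powr (2 / al - 1 / 2)"
    using K1 by (subst c_eq) (simp add: powr_diff[symmetric])
  then have "(c / K powr (3 / 2)) powr (al - 1) = K powr ((2 / al - 1 / 2) * (al - 1))"
    by (simp add: powr_powr)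
  also have "\<dots> \<le> K powr (1 / 2)"
  proof (rule powr_mono)
    have "0 \<le> (al - 2)\<^sup>2 / (2 * al)" using al by simp
    also have "\<dots> = 1 / 2 - (2 / al - 1 / 2) * (al - 1)"
      using al by (simp add: field_simps power2_eq_square)
    finally show "(2 / al - 1 / 2) * (al - 1) \<le> 1 / 2" by simp
  qed (use K1 in auto)
  finally show ?thesis .
qed

text \<open>Both the initial growth (\<open>P \<ge> const K\<^sup>3\<close>) and the oscillations (\<open>P \<ge> const c E\<^sub>N\<close>) bound \<open>P\<close> from below; the
  two resulting estimates are balanced at \<open>m = K^(3/2)\<close>.\<close>

lemma amplitude_le:
  assumes m: "1 \<le> m" "m \<le> N"
  shows "E u m / hh m \<le> flat * P * K powr (1 / 2) * (1 / real m)"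
proof (cases "real m \<le> K powr (3 / 2)")
  case True
  have "E u m \<le> G * (hh m / hh 1) * E u 1" using E_u_compare(1)[of 1 m] m by simp
  then have "E u m / hh m \<le> G * (1 / hh 1) * E u 1"
    using bh_bounds(4)[OF m] by (simp add: field_simps)
  also have "\<dots> \<le> G * K\<^sup>2 * (7 * C\<^sup>2)"
    using bh_bounds[of 1] N1 E_1_le E_nonneg[of 1 u] G1 K1
    by (intro mult_mono mult_left_mono) (auto simp: field_simps)
  also have "\<dots> \<le> 7 * C\<^sup>2 * G * (2592 * C ^ 3 * P) / K"
    using mult_left_mono[OF P_ge_cube, of "7 * C\<^sup>2 * G"] K1 G1 C
    by (simp add: field_simps power2_eq_square power3_eq_cube)
  also have "\<dots> = 18144 * C ^ 5 * G * P * (1 / K)"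
    by (simp add: power2_eq_square power3_eq_cube eval_nat_numeral)
  also have "\<dots> \<le> 18144 * C ^ 5 * G * P * (K powr (1 / 2) * (1 / real m))"
  proof (intro mult_left_mono)
    have "K powr (3 / 2) = K powr (1 / 2) * K powr 1" unfolding powr_add[symmetric] by simp
    then have "real m \<le> K powr (1 / 2) * K" using True K1 by simp
    then show "1 / K \<le> K powr (1 / 2) * (1 / real m)" using m K1 by (simp add: field_simps)
  qed (use G1 C P_pos in auto)
  also have "\<dots> \<le> flat * P * (K powr (1 / 2) * (1 / real m))"
    using G1 spread_pos kap P_pos by (intro mult_right_mono) (auto simp: flat_def)
  finally show ?thesis by simp
next
  case False
  then have m0: "0 < real m" using m by simp
  have "E u m / hh m \<le> 2 * G * E u N / hh m"
    using E_u_compare(2)[OF m] bh_bounds(4)[OF m] by (intro divide_right_mono) auto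
  also have "\<dots> \<le> 2 * G * (P / (spread * c)) / (kap * (real m / c) powr al)"
  proof (rule frac_le)
    show "2 * G * E u N \<le> 2 * G * (P / (spread * c))"
      using P_ge_spread spread_pos c0 G1 by (simp add: field_simps)
    show "0 < kap * (real m / c) powr al" using kap m0 c0 by simp
  qed (use hh_ge[OF m] G1 spread_pos c0 P_pos in auto)
  \<comment> \<open>One factor c / m of (c / m)^al cancels the c of \<open>P_ge_spread\<close> and
    leaves 1 / m; the rest does not increase with m and is evaluated at K^(3/2).\<close>
  also have "\<dots> = 2 * G / (spread * kap) * P * ((c / real m) powr (al - 1) * (1 / real m))"
  proof -
    have "(real m / c) powr al = (real m / c) powr (al - 1) * (real m / c)"
      using m0 c0 by (simp add: powr_diff)
    moreover have "(c / real m) powr (al - 1) = 1 / (real m / c) powr (al - 1)"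
      using m0 c0 by (simp add: powr_divide)
    ultimately show ?thesis using c0 by (simp add: field_simps)
  qed
  also have "\<dots> \<le> 2 * G / (spread * kap) * P * (K powr (1 / 2) * (1 / real m))"
  proof (intro mult_left_mono mult_right_mono)
    have "(c / real m) powr (al - 1) \<le> (c / K powr (3 / 2)) powr (al - 1)"
      using False K1 c0 al m0 by (intro powr_mono2 divide_left_mono) (auto intro!: mult_pos_pos)
    also note c_K_powr
    finally show "(c / real m) powr (al - 1) \<le> K powr (1 / 2)" .
  qed (use G1 spread_pos kap P_pos in auto)
  also have "\<dots> \<le> flat * P * (K powr (1 / 2) * (1 / real m))"
    using G1 C P_pos by (intro mult_right_mono) (auto simp: flat_def)
  finally show ?thesis by simp
qed

text \<open>Built from al, kap, C and nu alone, hence the same for all c once these parameters are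
  fixed.\<close>

definition cond :: real where
  "cond = 36 * G * C / kap * flat + 72 * G * C / (kap\<^sup>2 * nu powr al)"

lemma cond_pos: "0 < cond"
  using flat_pos G1 C kap nu by (auto simp: cond_def intro!: add_pos_pos divide_pos_pos mult_pos_pos)

lemma K_powr_7_2: "K powr (7 / 2) = K ^ 3 * K powr (1 / 2)"
proof -
  have "K ^ 3 = K powr 3" using K1 by simp
  then show ?thesis by (simp add: powr_add[symmetric])
qed

text \<open>The bound of \<open>sensitivity\<close> is a function of m times a function of j, so the
  double sum factors: K^3 H from j by \<open>sum_inverse_hh\<close>, K^(1/2) H from m by
  \<open>amplitude_le\<close>.\<close>

lemma sum_sensitivity_P:
  "(\<Sum>j=1..N. \<Sum>m=1..N + 1. 2 * \<bar>u m * w j m\<bar>) \<le> cond * K powr (7 / 2) * H\<^sup>2 * P"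
proof -
  define Y where "Y = (\<Sum>m=1..N. E u m / hh m)"
  have Y: "Y \<le> flat * P * K powr (1 / 2) * H"
    unfolding Y_def H_def sum_distrib_left by (intro sum_mono amplitude_le) auto
  have Y0: "0 \<le> Y" unfolding Y_def using E_nonneg bh_bounds by (intro sum_nonneg divide_nonneg_nonneg) (auto simp: less_imp_le)
  have "(\<Sum>m=1..N + 1. 2 * \<bar>u m * w j m\<bar>) \<le> 36 * G * C * Y * (1 / hh j)" if j: "j \<in> {1..N}" for j
  proof -
    have "(\<Sum>m=1..N + 1. 2 * \<bar>u m * w j m\<bar>) = (\<Sum>m=2..N + 1. 2 * \<bar>u m * w j m\<bar>)"
      using j by (intro sum.mono_neutral_right) (auto simp: resonance_eq_0)
    also have "\<dots> = (\<Sum>m=1..N. 2 * \<bar>u (m + 1) * w j (m + 1)\<bar>)"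
      by (rule sum.reindex_bij_witness[of _ "\<lambda>m. m + 1" "\<lambda>m. m - 1"]) auto
    also have "\<dots> \<le> (\<Sum>m=1..N. 36 * G * C * (1 / hh j) * (E u m / hh m))"
    proof (rule sum_mono)
      fix m assume m: "m \<in> {1..N}"
      show "2 * \<bar>u (m + 1) * w j (m + 1)\<bar> \<le> 36 * G * C * (1 / hh j) * (E u m / hh m)"
      proof (cases "j \<le> m")
        case True
        then have "\<bar>u m * w j m\<bar> + \<bar>u (m + 1) * w j (m + 1)\<bar> \<le> 18 * G * C * (E u m / hh m) / hh j"
          using sensitivity j m by simp
        then have "2 * \<bar>u (m + 1) * w j (m + 1)\<bar> \<le> 2 * (18 * G * C * (E u m / hh m) / hh j)"
          using abs_ge_zero[of "u m * w j m"] by linarith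
        then show ?thesis by (simp add: mult_ac)
      next
        case False
        then show ?thesis
          using m j G1 C E_nonneg[of m u] bh_bounds[of m] bh_bounds[of j]
          by (simp add: resonance_eq_0)
      qed
    qed
    also have "\<dots> = 36 * G * C * Y * (1 / hh j)" unfolding Y_def sum_distrib_left[symmetric] by simp
    finally show ?thesis .
  qed
  then have "(\<Sum>j=1..N. \<Sum>m=1..N + 1. 2 * \<bar>u m * w j m\<bar>) \<le> (\<Sum>j=1..N. 36 * G * C * Y * (1 / hh j))"
    by (rule sum_mono)
  also have "\<dots> = 36 * G * C * Y * (\<Sum>j=1..N. 1 / hh j)" by (simp add: sum_distrib_left)
  also have "\<dots> \<le> 36 * G * C * (flat * P * K powr (1 / 2) * H) * (K ^ 3 * H / kap)"
    using Y Y0 sum_inverse_hh G1 C flat_pos P_pos H1 bh_bounds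
    by (intro mult_mono sum_nonneg) (auto simp: less_imp_le)
  also have "\<dots> = 36 * G * C / kap * flat * (K powr (7 / 2) * H\<^sup>2 * P)"
    by (simp add: K_powr_7_2 power2_eq_square)
  also have "\<dots> \<le> cond * (K powr (7 / 2) * H\<^sup>2 * P)"
    using G1 C kap nu P_pos by (intro mult_right_mono) (auto simp: cond_def)
  finally show ?thesis by (simp add: mult.assoc)
qed

text \<open>At the last index \<open>hh\<close> is at least kap nu^al, so the loss from summing over
  m disappears; the bound is relaxed to the shape shared with \<open>P\<close>.\<close>

lemma sum_sensitivity_Q:
  "(\<Sum>j=1..N. 2 * \<bar>u N * w j N\<bar> + 2 * \<bar>u (N + 1) * w j (N + 1)\<bar>) \<le> cond * K powr (7 / 2) * H\<^sup>2 * Q"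
proof -
  have NN: "1 \<le> N" "N \<le> N" using N1 by auto
  have Q0: "0 \<le> Q" by (simp add: Q_def)
  define F where "F = E u N / hh N"
  have F0: "0 \<le> F" using E_nonneg[OF NN] bh_bounds[OF NN] by (simp add: F_def)
  have "nu powr al \<le> (real N / c) powr al"
    using size c0 nu al by (intro powr_mono2) (auto simp: field_simps)
  then have "kap * nu powr al \<le> kap * (real N / c) powr al" using kap by simp
  also note hh_ge[OF NN]
  finally have F: "F \<le> 2 * Q / (kap * nu powr al)"
    unfolding F_def using E_leq[OF NN, of u] kap nu by (intro frac_le) (auto simp: Q_def)
  have "(\<Sum>j=1..N. 2 * \<bar>u N * w j N\<bar> + 2 * \<bar>u (N + 1) * w j (N + 1)\<bar>)
      \<le> (\<Sum>j=1..N. 36 * G * C * F * (1 / hh j))"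
  proof (rule sum_mono)
    fix j assume "j \<in> {1..N}"
    then show "2 * \<bar>u N * w j N\<bar> + 2 * \<bar>u (N + 1) * w j (N + 1)\<bar> \<le> 36 * G * C * F * (1 / hh j)"
      using sensitivity[of j N] by (simp add: F_def)
  qed
  also have "\<dots> = 36 * G * C * F * (\<Sum>j=1..N. 1 / hh j)" by (simp add: sum_distrib_left)
  also have "\<dots> \<le> 36 * G * C * (2 * Q / (kap * nu powr al)) * (K ^ 3 * H / kap)"
    using F F0 sum_inverse_hh G1 C bh_bounds
    by (intro mult_mono sum_nonneg) (auto simp: less_imp_le Q0 nu kap)
  also have "\<dots> = 72 * G * C / (kap\<^sup>2 * nu powr al) * (K ^ 3 * H * 1 * Q)"
    by (simp add: power2_eq_square mult_ac)
  also have "\<dots> \<le> cond * (K ^ 3 * (H * H) * K powr (1 / 2) * Q)"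
  proof (intro mult_mono)
    show "72 * G * C / (kap\<^sup>2 * nu powr al) \<le> cond"
      using flat_pos G1 C kap by (simp add: cond_def)
    show "H \<le> H * H" using H1 by simp
    show "1 \<le> K powr (1 / 2)" using K1 by (intro ge_one_powr_ge_zero) auto
  qed (use H1 K1 cond_pos in \<open>auto simp: Q_def\<close>)
  finally show ?thesis by (simp add: K_powr_7_2 power2_eq_square mult.assoc mult.left_commute)
qed

text \<open>The energy at 1 is 1 + b 1 (b 1 - bh 1), at least 1, and comparison carries it to N.
  This keeps the gluing pair away from 0.\<close>

lemma Q_pos: "0 < Q"
proof -
  have "1 \<le> E u 1"
    using b_bounds[of 1] N1
    by (simp add: E_def energy_def numeral_2_eq_2 power2_eq_square algebra_simps bh_def mult_left_mono)
  also have "\<dots> \<le> 2 * G * E u N" using E_u_compare(2)[of 1 N] N1 by simp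
  also have "\<dots> \<le> 2 * G * (2 * Q)"
    unfolding Q_def using G1 N1 by (intro mult_left_mono E_leq) auto
  finally have "0 < G * Q" by linarith
  then show ?thesis using G1 by (simp add: zero_less_mult_iff)
qed

end


section \<open>First-order error of the glued vector\<close>

lemma left_seq_uminus_sq: "(left_seq (\<lambda>i. - b i) m)\<^sup>2 = (left_seq b m)\<^sup>2"
  by (simp add: left_seq_uminus power_mult_distrib power_mult[symmetric])

lemma resonance_uminus: "resonance (\<lambda>i. - b i) j m = (-1) ^ (m + 1) * resonance b j m"
proof -
  have "(\<lambda>i. - b i)(j := 2 * - b j) = (\<lambda>i. - (b(j := 2 * b j)) i)" by auto
  then show ?thesis unfolding resonance_def left_seq_uminus[symmetric]
    by (simp only: left_seq_uminus right_diff_distrib)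
qed

text \<open>Both factors carry the same sign, so estimates for the profile with coefficients -B are
  estimates for B itself.\<close>

lemma abs_left_seq_resonance_uminus:
  "\<bar>left_seq (\<lambda>i. - b i) m * resonance (\<lambda>i. - b i) j m\<bar> = \<bar>left_seq b m * resonance b j m\<bar>"
  by (simp add: left_seq_uminus resonance_uminus abs_mult power_abs)

lemma right_seq_perturb:
  assumes "1 \<le> j" "j \<le> n" "1 \<le> i"
  shows "right_seq n (\<lambda>k. B k * (1 + ((\<lambda>_. 0)(j := t)) k)) i
    = left_seq (\<lambda>k. B (n + 1 - k)) (n + 1 - i) + t * resonance (\<lambda>k. B (n + 1 - k)) (n + 1 - j) (n + 1 - i)"
proof -
  have "right_seq n (\<lambda>k. B k * (1 + ((\<lambda>_. 0)(j := t)) k)) i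
      = left_seq (\<lambda>k. B (n + 1 - k) * (1 + ((\<lambda>_. 0)(n + 1 - j := t)) k)) (n + 1 - i)"
    unfolding right_seq_def using assms by (intro left_seq_cong) auto
  then show ?thesis by (simp only: left_seq_perturb)
qed

text \<open>By \<open>ip\<close> the sign in the gluing factor squares to 1, so the squared norm is
  a rational function of the two sequences. The last two entries of y enter only the
  denominator.\<close>

lemma sum_glued_sq:
  assumes r: "1 \<le> r" "r < n"
    and ip: "left_seq B r * right_seq n B r + left_seq B (r + 1) * right_seq n B (r + 1) \<noteq> 0"
  defines "y \<equiv> left_seq (\<lambda>k. B (n + 1 - k))"
  shows "(\<Sum>i=1..n. (glued_seq n r B i)\<^sup>2) =
    (\<Sum>m=1..r + 1. (left_seq B m)\<^sup>2) +
    ((left_seq B r)\<^sup>2 + (left_seq B (r + 1))\<^sup>2) / ((y (n - r))\<^sup>2 + (y (n - r + 1))\<^sup>2) *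
    (\<Sum>m=1..n - r - 1. (y m)\<^sup>2)"
proof -
  have yr: "right_seq n B i = y (n + 1 - i)" for i by (simp add: right_seq_def y_def)
  have g: "(glue_factor n r B)\<^sup>2 =
      ((left_seq B r)\<^sup>2 + (left_seq B (r + 1))\<^sup>2) / ((y (n - r))\<^sup>2 + (y (n - r + 1))\<^sup>2)"
  proof -
    have "(sgn (left_seq B r * right_seq n B r + left_seq B (r + 1) * right_seq n B (r + 1)))\<^sup>2 = 1"
      using ip by (simp add: sgn_real_def)
    moreover have "n + 1 - r = n - r + 1" "n + 1 - (r + 1) = n - r" using r by auto
    ultimately show ?thesis
      by (simp add: glue_factor_def Let_def power_mult_distrib yr add.commute del: left_seq.simps)
  qed
  have "(\<Sum>i=1..n. (glued_seq n r B i)\<^sup>2) =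
      (\<Sum>i=1..r + 1. (glued_seq n r B i)\<^sup>2) + (\<Sum>i=r + 2..n. (glued_seq n r B i)\<^sup>2)"
  proof -
    have "{1..n} = {1..r + 1} \<union> {r + 2..n}" using r by auto
    then show ?thesis by (simp add: sum.union_disjoint)
  qed
  also have "(\<Sum>i=1..r + 1. (glued_seq n r B i)\<^sup>2) = (\<Sum>m=1..r + 1. (left_seq B m)\<^sup>2)"
    by (intro sum.cong) (auto simp: glued_seq_def)
  also have "(\<Sum>i=r + 2..n. (glued_seq n r B i)\<^sup>2) =
      (\<Sum>i=r + 2..n. (glue_factor n r B)\<^sup>2 * (y (n + 1 - i))\<^sup>2)"
    by (intro sum.cong) (auto simp: glued_seq_def yr power_mult_distrib)
  also have "\<dots> = (glue_factor n r B)\<^sup>2 * (\<Sum>m=1..n - r - 1. (y m)\<^sup>2)"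
    unfolding sum_distrib_left
    by (rule sum.reindex_bij_witness[of _ "\<lambda>m. n + 1 - m" "\<lambda>m. n + 1 - m"]) auto
  finally show ?thesis by (simp only: g)
qed

lemma DERIV_affine_sq: "((\<lambda>t. (p + t * q)\<^sup>2) has_real_derivative 2 * p * q) (at 0)"
  by (auto intro!: derivative_eq_intros)

text \<open>Equality near 0 is enough, as the formula for the norm is available only while the
  gluing sign is nonzero.\<close>

lemma deriv_inverse_sqrt:
  fixes f g :: "real \<Rightarrow> real"
  assumes ev: "\<forall>\<^sub>F t in nhds 0. f t = 1 / sqrt (g t)"
    and g: "(g has_real_derivative g') (at 0)" "0 < g 0"
  shows "\<bar>deriv f 0\<bar> = \<bar>g'\<bar> / (2 * g 0) * \<bar>f 0\<bar>"
proof -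
  have "((\<lambda>t. 1 / sqrt (g t)) has_real_derivative - (g' / (2 * sqrt (g 0))) / g 0) (at 0)"
    using g by (auto intro!: derivative_eq_intros simp: field_simps)
  then have "(f has_real_derivative - (g' / (2 * sqrt (g 0))) / g 0) (at 0)"
    using DERIV_cong_ev[OF refl ev refl] by simp
  then have "deriv f 0 = - (g' / (2 * sqrt (g 0))) / g 0" by (rule DERIV_imp_deriv)
  moreover have "f 0 = 1 / sqrt (g 0)" using ev eventually_nhds_x_imp_x by blast
  ultimately show ?thesis using g by (simp add: abs_mult)
qed

lemma rel_err_le:
  assumes "0 \<le> eps"
    and u: "u (\<lambda>_. 0) \<noteq> 0"
    and D: "\<And>j. j \<in> {1..n} \<Longrightarrow> \<bar>deriv (\<lambda>t. u ((\<lambda>_. 0)(j := t))) 0\<bar> \<le> D j * \<bar>u (\<lambda>_. 0)\<bar>"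
  shows "rel_err eps n u \<le> eps * (\<Sum>j=1..n. D j)"
proof -
  have "(SUP d \<in> {d. \<forall>j\<in>{1..n}. \<bar>d j\<bar> \<le> 1}. \<bar>\<Sum>j=1..n. d j * deriv (\<lambda>t. u ((\<lambda>_. 0)(j := t))) 0\<bar>)
      \<le> (\<Sum>j=1..n. D j) * \<bar>u (\<lambda>_. 0)\<bar>"
  proof (rule cSUP_least)
    show "{d :: nat \<Rightarrow> real. \<forall>j\<in>{1..n}. \<bar>d j\<bar> \<le> 1} \<noteq> {}"
      by (rule ex_in_conv[THEN iffD1], rule exI[of _ "\<lambda>_. 0"]) simp
  next
    fix d :: "nat \<Rightarrow> real" assume d: "d \<in> {d. \<forall>j\<in>{1..n}. \<bar>d j\<bar> \<le> 1}"
    have "\<bar>\<Sum>j=1..n. d j * deriv (\<lambda>t. u ((\<lambda>_. 0)(j := t))) 0\<bar>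
        \<le> (\<Sum>j=1..n. \<bar>d j * deriv (\<lambda>t. u ((\<lambda>_. 0)(j := t))) 0\<bar>)" by (rule sum_abs)
    also have "\<dots> \<le> (\<Sum>j=1..n. D j * \<bar>u (\<lambda>_. 0)\<bar>)"
    proof (rule sum_mono)
      fix j assume j: "j \<in> {1..n}"
      have "\<bar>d j * deriv (\<lambda>t. u ((\<lambda>_. 0)(j := t))) 0\<bar> \<le> 1 * (D j * \<bar>u (\<lambda>_. 0)\<bar>)"
        unfolding abs_mult using d D[OF j] j by (intro mult_mono) auto
      then show "\<bar>d j * deriv (\<lambda>t. u ((\<lambda>_. 0)(j := t))) 0\<bar> \<le> D j * \<bar>u (\<lambda>_. 0)\<bar>" by simp
    qed
    also have "\<dots> = (\<Sum>j=1..n. D j) * \<bar>u (\<lambda>_. 0)\<bar>" by (simp add: sum_distrib_right)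
    finally show "\<bar>\<Sum>j=1..n. d j * deriv (\<lambda>t. u ((\<lambda>_. 0)(j := t))) 0\<bar> \<le> \<dots>" .
  qed
  then have "eps * (SUP d \<in> {d. \<forall>j\<in>{1..n}. \<bar>d j\<bar> \<le> 1}. \<bar>\<Sum>j=1..n. d j * deriv (\<lambda>t. u ((\<lambda>_. 0)(j := t))) 0\<bar>)
      \<le> eps * ((\<Sum>j=1..n. D j) * \<bar>u (\<lambda>_. 0)\<bar>)"
    using \<open>0 \<le> eps\<close> by (rule mult_left_mono)
  then show ?thesis unfolding rel_err_def using u by (simp add: field_simps)
qed

text \<open>X_1 is the power -1/2 of P + (Q / S) R. Coefficients with j <= r act on x only, those
  with j > r on y only. The bounds for P and Q give L1 once; those for R + S and for S give L2 each,
  the latter through the denominator.\<close>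

lemma rel_err_glued:
  fixes B :: "nat \<Rightarrow> real"
  assumes eps: "0 \<le> eps" and r: "1 \<le> r" "r < n"
  defines "x \<equiv> left_seq B" and "wx \<equiv> resonance B"
  defines "bb \<equiv> \<lambda>k. B (n + 1 - k)" and "M \<equiv> n - r"
  defines "y \<equiv> left_seq bb" and "wy \<equiv> resonance bb"
  assumes ip: "x r * y (M + 1) + x (r + 1) * y M \<noteq> 0"
    and XP: "(\<Sum>j=1..r. \<Sum>m=1..r + 1. 2 * \<bar>x m * wx j m\<bar>) \<le> L1 * (\<Sum>m=1..r + 1. (x m)\<^sup>2)"
    and XQ: "(\<Sum>j=1..r. 2 * \<bar>x r * wx j r\<bar> + 2 * \<bar>x (r + 1) * wx j (r + 1)\<bar>)
               \<le> L1 * ((x r)\<^sup>2 + (x (r + 1))\<^sup>2)"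
    and YP: "(\<Sum>j=1..M. \<Sum>m=1..M + 1. 2 * \<bar>y m * wy j m\<bar>) \<le> L2 * (\<Sum>m=1..M + 1. (y m)\<^sup>2)"
    and YQ: "(\<Sum>j=1..M. 2 * \<bar>y M * wy j M\<bar> + 2 * \<bar>y (M + 1) * wy j (M + 1)\<bar>)
               \<le> L2 * ((y M)\<^sup>2 + (y (M + 1))\<^sup>2)"
    and L: "0 \<le> L1" "0 \<le> L2"
  shows "rel_err eps n (\<lambda>d. computed_vec n r (\<lambda>j. B j * (1 + d j)) 1) \<le> eps * (L1 + 2 * L2)"
proof -
  define u where "u = (\<lambda>d. computed_vec n r (\<lambda>j. B j * (1 + d j)) 1)"
  define P Q R S where "P = (\<Sum>m=1..r + 1. (x m)\<^sup>2)" and "Q = (x r)\<^sup>2 + (x (r + 1))\<^sup>2"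
    and "R = (\<Sum>m=1..M - 1. (y m)\<^sup>2)" and "S = (y M)\<^sup>2 + (y (M + 1))\<^sup>2"
  define Gt where "Gt = P + Q / S * R"
  define pj where "pj = (\<lambda>j. \<Sum>m=1..r + 1. 2 * \<bar>x m * wx j m\<bar>)"
  define qj where "qj = (\<lambda>j. 2 * \<bar>x r * wx j r\<bar> + 2 * \<bar>x (r + 1) * wx j (r + 1)\<bar>)"
  define rj where "rj = (\<lambda>j. \<Sum>m=1..M - 1. 2 * \<bar>y m * wy j m\<bar>)"
  define sj where "sj = (\<lambda>j. 2 * \<bar>y M * wy j M\<bar> + 2 * \<bar>y (M + 1) * wy j (M + 1)\<bar>)"
  define D where "D = (\<lambda>j. (pj j + qj j * (R / S) + Q / S * rj (n + 1 - j) + Q * R / S / S * sj (n + 1 - j)) / Gt)"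
  have M: "n + 1 - r = M + 1" "n + 1 - (r + 1) = M" "n - r + 1 = M + 1" "n - r = M" "1 \<le> M"
    using r by (auto simp: M_def)
  have x1: "x 1 = 1" by (simp add: x_def)
  have "(x 1)\<^sup>2 \<le> P" unfolding P_def by (intro member_le_sum) auto
  then have P0: "0 < P" using x1 by simp
  have Q0: "0 \<le> Q" and R0: "0 \<le> R" by (auto simp: Q_def R_def intro: sum_nonneg)
  have S0: "0 < S"
  proof -
    have "y M \<noteq> 0 \<or> y (M + 1) \<noteq> 0" using ip by auto
    then show ?thesis unfolding S_def by (auto simp: add_pos_nonneg add_nonneg_pos)
  qed
  have G0: "0 < Gt" "P \<le> Gt" "Q / S * R \<le> Gt" using P0 Q0 R0 S0 by (auto simp: Gt_def add_pos_nonneg)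
  have deriv: "\<bar>deriv (\<lambda>t. u ((\<lambda>_. 0)(j := t))) 0\<bar> \<le> D j * \<bar>u (\<lambda>_. 0)\<bar>" and u0: "u (\<lambda>_. 0) \<noteq> 0"
    if j: "j \<in> {1..n}" for j
  proof -
    define j' where "j' = n + 1 - j"
    define Bt where "Bt = (\<lambda>t k. B k * (1 + ((\<lambda>_. 0)(j := t)) k))"
    have xt: "left_seq (Bt t) m = x m + t * wx j m" for t m
      unfolding Bt_def x_def wx_def by (rule left_seq_perturb)
    have rt: "right_seq n (Bt t) i = y (n + 1 - i) + t * wy j' (n + 1 - i)" if "1 \<le> i" for t i
      unfolding Bt_def y_def wy_def bb_def j'_def using that j by (intro right_seq_perturb) auto
    have yt: "left_seq (\<lambda>k. Bt t (n + 1 - k)) m = y m + t * wy j' m" if "m \<le> n" for t m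
      using rt[of "n + 1 - m" t] that by (simp add: right_seq_def)
    define p where "p = (\<lambda>t. \<Sum>m=1..r + 1. (x m + t * wx j m)\<^sup>2)"
    define q where "q = (\<lambda>t. (x r + t * wx j r)\<^sup>2 + (x (r + 1) + t * wx j (r + 1))\<^sup>2)"
    define rr where "rr = (\<lambda>t. \<Sum>m=1..M - 1. (y m + t * wy j' m)\<^sup>2)"
    define s where "s = (\<lambda>t. (y M + t * wy j' M)\<^sup>2 + (y (M + 1) + t * wy j' (M + 1))\<^sup>2)"
    define g where "g = (\<lambda>t. p t + q t / s t * rr t)"
    have at0: "p 0 = P" "q 0 = Q" "rr 0 = R" "s 0 = S" "g 0 = Gt"
      by (simp_all add: p_def q_def rr_def s_def g_def P_def Q_def R_def S_def Gt_def)
    \<comment> \<open>Continuous and nonzero at 0, so \<open>sum_glued_sq\<close> applies for all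
      small t.\<close>
    define ipt where "ipt = (\<lambda>t. (x r + t * wx j r) * (y (M + 1) + t * wy j' (M + 1))
      + (x (r + 1) + t * wx j (r + 1)) * (y M + t * wy j' M))"
    have "isCont ipt 0" unfolding ipt_def by (intro continuous_intros)
    then have "(ipt \<longlongrightarrow> ipt 0) (nhds 0)" by (simp add: continuous_within tendsto_at_iff_tendsto_nhds)
    moreover have "ipt 0 \<noteq> 0" using ip by (simp add: ipt_def)
    ultimately have "\<forall>\<^sub>F t in nhds 0. ipt t \<noteq> 0" by (rule tendsto_imp_eventually_ne)
    then have ev: "\<forall>\<^sub>F t in nhds 0. u ((\<lambda>_. 0)(j := t)) = 1 / sqrt (g t)"
    proof eventually_elim
      case (elim t)
      have y: "right_seq n (Bt t) r = y (M + 1) + t * wy j' (M + 1)"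
          "right_seq n (Bt t) (r + 1) = y M + t * wy j' M"
        using rt[of r t] rt[of "r + 1" t] r M le_add2[of 1 r] by metis+
      have ne: "left_seq (Bt t) r * right_seq n (Bt t) r
          + left_seq (Bt t) (r + 1) * right_seq n (Bt t) (r + 1) \<noteq> 0"
        using elim unfolding ipt_def xt y .
      have Mn: "M \<le> n" "M + 1 \<le> n" "M - 1 \<le> n" using r by (auto simp: M_def)
      have "(\<Sum>m=1..M - 1. (left_seq (\<lambda>k. Bt t (n + 1 - k)) m)\<^sup>2) = rr t"
        unfolding rr_def
      proof (rule sum.cong[OF refl])
        fix m assume "m \<in> {1..M - 1}"
        then have "m \<le> n" using Mn by simp
        then show "(left_seq (\<lambda>k. Bt t (n + 1 - k)) m)\<^sup>2 = (y m + t * wy j' m)\<^sup>2"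
          by (simp only: yt)
      qed
      then have "(\<Sum>i=1..n. (glued_seq n r (Bt t) i)\<^sup>2) = g t"
        unfolding sum_glued_sq[OF r ne] M xt yt[OF Mn(1)] yt[OF Mn(2)] g_def p_def q_def s_def
        by (simp only:)
      moreover have "glued_seq n r (Bt t) 1 = 1" by (simp add: glued_seq_def)
      ultimately show ?case by (simp add: u_def Bt_def computed_vec_def)
    qed
    have u00: "u (\<lambda>_. 0) = u ((\<lambda>_. 0)(j := 0))" by (simp add: fun_upd_idem)
    have "u ((\<lambda>_. 0)(j := 0)) = 1 / sqrt (g 0)" using ev eventually_nhds_x_imp_x by blast
    then show "u (\<lambda>_. 0) \<noteq> 0" unfolding u00 at0 using G0 by simp
    define p' q' r' s' where "p' = (\<Sum>m=1..r + 1. 2 * x m * wx j m)"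
      and "q' = 2 * x r * wx j r + 2 * x (r + 1) * wx j (r + 1)"
      and "r' = (\<Sum>m=1..M - 1. 2 * y m * wy j' m)"
      and "s' = 2 * y M * wy j' M + 2 * y (M + 1) * wy j' (M + 1)"
    have d: "(p has_real_derivative p') (at 0)" "(q has_real_derivative q') (at 0)"
        "(rr has_real_derivative r') (at 0)" "(s has_real_derivative s') (at 0)"
      unfolding p_def q_def rr_def s_def p'_def q'_def r'_def s'_def
      by (intro DERIV_sum DERIV_add DERIV_affine_sq)+
    define g' where "g' = p' + (q' * R / S + Q / S * r' - Q * R / S / S * s')"
    have *: "((\<lambda>t. p t + q t / s t * rr t) has_real_derivative
        p' + ((q' * s 0 - q 0 * s') / (s 0 * s 0) * rr 0 + r' * (q 0 / s 0))) (at 0)"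
      using S0 at0 by (intro DERIV_add DERIV_mult DERIV_divide d) auto
    have g: "(g has_real_derivative g') (at 0)"
    proof -
      have "p' + ((q' * S - Q * s') / (S * S) * R + r' * (Q / S)) = g'"
        using S0 by (simp add: g'_def field_simps)
      with * show ?thesis by (simp only: at0 g_def)
    qed
    have "\<bar>deriv (\<lambda>t. u ((\<lambda>_. 0)(j := t))) 0\<bar> = \<bar>g'\<bar> / (2 * g 0) * \<bar>u ((\<lambda>_. 0)(j := 0))\<bar>"
      by (rule deriv_inverse_sqrt[OF ev g]) (use at0 G0 in simp)
    also have "\<dots> \<le> D j * \<bar>u (\<lambda>_. 0)\<bar>"
      unfolding u00 at0
    proof (rule mult_right_mono)
      have "\<bar>p'\<bar> \<le> pj j" unfolding p'_def pj_def
        by (rule order_trans[OF sum_abs]) (simp add: abs_mult mult.assoc)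
      moreover have "\<bar>q'\<bar> \<le> qj j" unfolding q'_def qj_def
        by (rule order_trans[OF abs_triangle_ineq]) (simp add: abs_mult mult.assoc)
      moreover have "\<bar>r'\<bar> \<le> rj j'" unfolding r'_def rj_def
        by (rule order_trans[OF sum_abs]) (simp add: abs_mult mult.assoc)
      moreover have "\<bar>s'\<bar> \<le> sj j'" unfolding s'_def sj_def
        by (rule order_trans[OF abs_triangle_ineq]) (simp add: abs_mult mult.assoc)
      ultimately have "\<bar>p'\<bar> + \<bar>q'\<bar> * R / S + Q / S * \<bar>r'\<bar> + Q * R / S / S * \<bar>s'\<bar>
          \<le> pj j + qj j * R / S + Q / S * rj j' + Q * R / S / S * sj j'"
        using Q0 R0 S0 by (intro add_mono mult_left_mono divide_right_mono mult_right_mono) auto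
      moreover have tri: "\<bar>k + (l + m - z)\<bar> \<le> \<bar>k\<bar> + \<bar>l\<bar> + \<bar>m\<bar> + \<bar>z\<bar>" for k l m z :: real
        by linarith
      have "\<bar>g'\<bar> \<le> \<bar>p'\<bar> + \<bar>q' * R / S\<bar> + \<bar>Q / S * r'\<bar> + \<bar>Q * R / S / S * s'\<bar>"
        unfolding g'_def by (rule tri)
      then have "\<bar>g'\<bar> \<le> \<bar>p'\<bar> + \<bar>q'\<bar> * R / S + Q / S * \<bar>r'\<bar> + Q * R / S / S * \<bar>s'\<bar>"
        using Q0 R0 S0 by (simp add: abs_mult abs_divide)
      ultimately have "\<bar>g'\<bar> \<le> pj j + qj j * R / S + Q / S * rj j' + Q * R / S / S * sj j'"
        by linarith
      then show "\<bar>g'\<bar> / (2 * Gt) \<le> D j"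
        unfolding D_def j'_def using G0 by (intro frac_le) auto
    qed simp
    finally show "\<bar>deriv (\<lambda>t. u ((\<lambda>_. 0)(j := t))) 0\<bar> \<le> D j * \<bar>u (\<lambda>_. 0)\<bar>" .
  qed
  have n1: "1 \<in> {1..n}" using r by auto
  have "rel_err eps n u \<le> eps * (\<Sum>j=1..n. D j)"
    using deriv u0[OF n1] by (intro rel_err_le eps) auto
  also have "(\<Sum>j=1..n. D j) \<le> L1 + 2 * L2"
  proof -
    have Sp: "(\<Sum>j=1..n. pj j) \<le> L1 * P"
    proof -
      have "(\<Sum>j=1..n. pj j) = (\<Sum>j=1..r. pj j)"
        using r by (intro sum.mono_neutral_right) (auto simp: pj_def wx_def resonance_eq_0)
      then show ?thesis using XP by (simp add: pj_def P_def)
    qed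
    have Sq: "(\<Sum>j=1..n. qj j) \<le> L1 * Q"
    proof -
      have "(\<Sum>j=1..n. qj j) = (\<Sum>j=1..r. qj j)"
        using r by (intro sum.mono_neutral_right) (auto simp: qj_def wx_def resonance_eq_0)
      then show ?thesis using XQ by (simp add: qj_def Q_def)
    qed
    have flip: "(\<Sum>j=1..n. f (n + 1 - j)) = (\<Sum>j=1..n. f j)" for f :: "nat \<Rightarrow> real"
      by (rule sum.reindex_bij_witness[of _ "\<lambda>m. n + 1 - m" "\<lambda>m. n + 1 - m"]) auto
    have Sr: "(\<Sum>j=1..n. rj (n + 1 - j)) \<le> L2 * (R + S)"
    proof -
      have "(\<Sum>j=1..n. rj (n + 1 - j)) = (\<Sum>j=1..n. rj j)" by (rule flip)
      also have "\<dots> = (\<Sum>j=1..M. rj j)"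
        using r by (intro sum.mono_neutral_right) (auto simp: rj_def wy_def resonance_eq_0 M_def intro!: sum.neutral)
      also have "\<dots> \<le> (\<Sum>j=1..M. \<Sum>m=1..M + 1. 2 * \<bar>y m * wy j m\<bar>)"
        unfolding rj_def by (intro sum_mono sum_mono2) auto
      also note YP
      also have "(\<Sum>m=1..M + 1. (y m)\<^sup>2) = R + S"
      proof -
        have "{1..M + 1} = {1..M - 1} \<union> {M, M + 1}" using M by auto
        moreover have "(\<Sum>m\<in>{1..M - 1} \<union> {M, M + 1}. (y m)\<^sup>2) = R + (\<Sum>m\<in>{M, M + 1}. (y m)\<^sup>2)"
          unfolding R_def using M by (intro sum.union_disjoint) auto
        ultimately show ?thesis by (simp add: S_def)
      qed
      finally show ?thesis .
    qed
    have Ss: "(\<Sum>j=1..n. sj (n + 1 - j)) \<le> L2 * S"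
    proof -
      have "(\<Sum>j=1..n. sj (n + 1 - j)) = (\<Sum>j=1..n. sj j)" by (rule flip)
      also have "\<dots> = (\<Sum>j=1..M. sj j)"
        using r by (intro sum.mono_neutral_right) (auto simp: sj_def wy_def resonance_eq_0 M_def)
      finally show ?thesis using YQ by (simp add: sj_def S_def)
    qed
    \<comment> \<open>Absorbs the summand Q that arises because L2 bounds R + S instead of
      R.\<close>
    have QP: "Q \<le> P"
    proof -
      have "(\<Sum>m\<in>{r, r + 1}. (x m)\<^sup>2) \<le> P" unfolding P_def using r by (intro sum_mono2) auto
      then show ?thesis by (simp add: Q_def)
    qed
    have "(\<Sum>j=1..n. D j) * Gt = (\<Sum>j=1..n. pj j) + (\<Sum>j=1..n. qj j) * (R / S)
        + (Q / S) * (\<Sum>j=1..n. rj (n + 1 - j)) + (Q * R / S / S) * (\<Sum>j=1..n. sj (n + 1 - j))"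
      unfolding D_def sum_divide_distrib[symmetric] sum.distrib sum_distrib_left[symmetric]
        sum_distrib_right[symmetric] using G0 by simp
    also have "\<dots> \<le> L1 * P + L1 * Q * (R / S) + Q / S * (L2 * (R + S)) + Q * R / S / S * (L2 * S)"
      using Sp Sq Sr Ss Q0 R0 S0 by (intro add_mono mult_left_mono mult_right_mono) auto
    also have "\<dots> = L1 * Gt + L2 * (Q + Q / S * R) + L2 * (Q / S * R)"
      using S0 by (simp add: Gt_def field_simps)
    also have "\<dots> \<le> L1 * Gt + L2 * Gt + L2 * Gt"
      using L QP G0 by (intro add_mono mult_left_mono) (auto simp: Gt_def)
    finally have "(\<Sum>j=1..n. D j) * Gt \<le> (L1 + 2 * L2) * Gt" by (simp add: algebra_simps)
    then show ?thesis using G0 by simp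
  qed
  finally show ?thesis using eps unfolding u_def by (simp add: mult_left_mono)
qed


section \<open>Asymptotics\<close>

text \<open>Extension by 0 to the indices 0 and n + 1 makes the first and last rows instances of the
  same recurrence.\<close>

lemma tridiag_eigenvector_recurrence:
  assumes X: "eigenvector (tridiag_mat a c n) X lam" and j: "1 \<le> j" "j \<le> n"
  defines "v \<equiv> \<lambda>j. if 1 \<le> j \<and> j \<le> n then vec_index X (j - 1) else 0"
  shows "v (j + 1) = (lam - diag_entry a c j) * v j - v (j - 1)"
proof -
  define A where "A = tridiag_mat a c n"
  have Xc: "dim_vec X = n" and eq: "A *\<^sub>v X = lam \<cdot>\<^sub>v X"
    using X by (auto simp: eigenvector_def A_def tridiag_mat_def)
  define i where "i = j - 1"
  have i: "i < n" "j = Suc i" using j by (auto simp: i_def)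
  have "lam * vec_index X i = vec_index (A *\<^sub>v X) i"
    using eq Xc i by simp
  also have "\<dots> = scalar_prod (row A i) X" using i by (simp add: A_def tridiag_mat_def)
  also have "\<dots> = (\<Sum>k = 0..<n. vec_index (row A i) k * vec_index X k)"
    by (simp only: scalar_prod_def Xc)
  also have "\<dots> = (\<Sum>k = 0..<n. (if i = k then diag_entry a c (Suc i)
      else if i = Suc k \<or> k = Suc i then 1 else 0) * vec_index X k)"
    using i by (intro sum.cong[OF refl] arg_cong2[of _ _ _ _ times]) (simp_all add: A_def tridiag_mat_def)
  also have "\<dots> = (\<Sum>k = 0..<n. (if k = i then diag_entry a c j * vec_index X k else 0) +
      ((if Suc k = i then vec_index X k else 0) + (if k = Suc i then vec_index X k else 0)))"
    by (intro sum.cong) (auto simp: i)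
  also have "\<dots> = diag_entry a c j * v j + (v (j - 1) + v (j + 1))"
  proof -
    have "(\<Sum>k = 0..<n. if Suc k = i then vec_index X k else 0) = v (j - 1)"
    proof (cases i)
      case 0
      then show ?thesis by (simp add: v_def i)
    next
      case (Suc l)
      then show ?thesis using i by (simp add: v_def)
    qed
    then show ?thesis using i by (simp add: sum.distrib v_def)
  qed
  finally show ?thesis using i by (simp add: v_def algebra_simps)
qed

lemma recurrence_unique:
  assumes "v 0 = 0" and "\<And>j. 1 \<le> j \<Longrightarrow> j \<le> n \<Longrightarrow> v (j + 1) = B j * v j - v (j - 1)" and "j \<le> n + 1"
  shows "v j = v 1 * left_seq B j"
  using assms(3)
proof (induction j rule: less_induct)
  case (less j)
  define k where "k = j - 1"
  consider "j = 0" | "j = 1" | "j = k + 1" "1 \<le> k" unfolding k_def by linarith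
  then show ?case
  proof cases
    case 3
    then have "v j = B k * v k - v (k - 1)" using assms(2)[of k] less.prems by simp
    moreover have "v k = v 1 * left_seq B k" using 3 less.prems by (intro less.IH) auto
    moreover have "v (k - 1) = v 1 * left_seq B (k - 1)" using 3 less.prems by (intro less.IH) auto
    moreover have "left_seq B j = B k * left_seq B k - left_seq B (k - 1)"
      using 3 left_seq_step[of k B] by (simp only:)
    ultimately show ?thesis by (simp only: right_diff_distrib mult.left_commute)
  qed (use assms(1) in auto)
qed

lemma tridiag_eigenvector_glue:
  assumes X: "eigenvector (tridiag_mat a c n) X lam"
  defines "B \<equiv> \<lambda>j. lam - diag_entry a c j"
  defines "x \<equiv> left_seq B" and "y \<equiv> left_seq (\<lambda>k. B (n + 1 - k))"
  shows "scalar_prod X X = (vec_index X 0)\<^sup>2 * (\<Sum>j=1..n. (x j)\<^sup>2)"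
    \<comment> \<open>so the sign in the gluing factor is not 0 and is locally constant under perturbation\<close>
    and "1 \<le> r \<Longrightarrow> r < n \<Longrightarrow> 0 < (x r)\<^sup>2 + (x (r + 1))\<^sup>2 \<Longrightarrow>
      x r * y (n - r + 1) + x (r + 1) * y (n - r) \<noteq> 0"
proof -
  define v where "v = (\<lambda>j. if 1 \<le> j \<and> j \<le> n then vec_index X (j - 1) else 0)"
  have Xc: "dim_vec X = n" and X0: "X \<noteq> 0\<^sub>v n"
    using X by (auto simp: eigenvector_def tridiag_mat_def)
  obtain i where i: "i < n" "vec_index X i \<noteq> 0"
    using X0 Xc by (metis eq_vecI index_zero_vec)
  have rec: "v (j + 1) = B j * v j - v (j - 1)" if "1 \<le> j" "j \<le> n" for j
    unfolding v_def B_def using tridiag_eigenvector_recurrence[OF X that] by simp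
  have vx: "v j = v 1 * x j" if "j \<le> n + 1" for j
    unfolding x_def using rec that by (intro recurrence_unique) (auto simp: v_def)
  \<comment> \<open>Read from the other end, the zero at n + 1 takes the place of the zero at 0, so
    the eigenvector is also a multiple of the backward sequence.\<close>
  have vy: "v (n + 1 - j) = v n * y j" if "j \<le> n + 1" for j
  proof -
    define v' where "v' = (\<lambda>j. v (n + 1 - j))"
    have "v' j = v' 1 * left_seq (\<lambda>k. B (n + 1 - k)) j"
    proof (rule recurrence_unique[OF _ _ that])
      show "v' 0 = 0" by (simp add: v'_def v_def)
      fix k assume k: "1 \<le> k" "k \<le> n"
      then have "n + 1 - k + 1 = n + 1 - (k - 1)" "n + 1 - k - 1 = n + 1 - (k + 1)"
        "1 \<le> n + 1 - k" "n + 1 - k \<le> n" by auto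
      then have "v (n + 1 - (k - 1)) = B (n + 1 - k) * v (n + 1 - k) - v (n + 1 - (k + 1))"
        using rec[of "n + 1 - k"] by (simp only:)
      then show "v' (k + 1) = B (n + 1 - k) * v' k - v' (k - 1)"
        unfolding v'_def by linarith
    qed
    then show ?thesis by (simp add: v'_def y_def)
  qed
  have v1: "v 1 = vec_index X 0" using i by (simp add: v_def)
  have "scalar_prod X X = (\<Sum>k = 0..<n. (vec_index X k)\<^sup>2)"
    by (simp add: scalar_prod_def Xc power2_eq_square)
  also have "\<dots> = (\<Sum>j=1..n. (v j)\<^sup>2)"
    by (rule sum.reindex_bij_witness[of _ "\<lambda>j. j - 1" "\<lambda>k. k + 1"]) (auto simp: v_def)
  also have "\<dots> = (\<Sum>j=1..n. (v 1)\<^sup>2 * (x j)\<^sup>2)"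
  proof (rule sum.cong[OF refl])
    fix j assume "j \<in> {1..n}"
    then have "v j = v 1 * x j" by (intro vx) auto
    then show "(v j)\<^sup>2 = (v 1)\<^sup>2 * (x j)\<^sup>2" by (simp only: power_mult_distrib)
  qed
  finally show "scalar_prod X X = (vec_index X 0)\<^sup>2 * (\<Sum>j=1..n. (x j)\<^sup>2)"
    unfolding v1 sum_distrib_left .
  have vi: "v (i + 1) \<noteq> 0" using i by (simp add: v_def)
  have v1n: "v 1 \<noteq> 0" "v n \<noteq> 0"
  proof -
    have "v (i + 1) = v 1 * x (i + 1)" using i by (intro vx) auto
    then show "v 1 \<noteq> 0" using vi by auto
    have "v (n + 1 - (n - i)) = v n * y (n - i)" using i by (intro vy) auto
    moreover have "n + 1 - (n - i) = i + 1" using i by auto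
    ultimately show "v n \<noteq> 0" using vi by auto
  qed
  assume r: "1 \<le> r" "r < n" and Q: "0 < (x r)\<^sup>2 + (x (r + 1))\<^sup>2"
  \<comment> \<open>Both pairs at r are parallel to (v r, v (r + 1)), so their inner product is a
    nonzero multiple of the squared length of the x pair.\<close>
  have "v r = v n * y (n - r + 1)" "v (r + 1) = v n * y (n - r)"
    using vy[of "n - r + 1"] vy[of "n - r"] r by auto
  then have "v n * (x r * y (n - r + 1) + x (r + 1) * y (n - r)) = v 1 * ((x r)\<^sup>2 + (x (r + 1))\<^sup>2)"
    using vx[of r] vx[of "r + 1"] r by (simp add: algebra_simps power2_eq_square)
  also have "\<dots> \<noteq> 0" using v1n(1) Q by (metis less_irrefl mult_eq_0_iff)
  finally show "x r * y (n - r + 1) + x (r + 1) * y (n - r) \<noteq> 0" by auto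
qed

lemma harmonic_sum_le:
  assumes "1 \<le> N" "real N \<le> 3 * c" "1 \<le> c"
  shows "(\<Sum>i=1..N. 1 / real i) \<le> 1 + ln (3 * c)"
proof -
  have "harm N - ln (real N) \<le> (harm 1 - ln (real 1) :: real)"
    using assms by (intro euler_mascheroni_sequence_decreasing) auto
  then have "(\<Sum>i=1..N. 1 / real i) \<le> 1 + ln (real N)"
    by (simp add: harm_def inverse_eq_divide)
  also have "ln (real N) \<le> ln (3 * c)" using assms by simp
  finally show ?thesis by simp
qed

section \<open>The coefficients on either side of the splitting index form profiles\<close>

text \<open>eta stands for (lambda - 4) / 2, so 2 - B_j = 2 (j / c)^a - 2 eta. Once (j / c)^a is at
  least 2 eta it dominates eta; before that it is below 2 D / K^2, which fixes kap. The value nu =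
  1/2 holds because r + 1 >= c >= 2.\<close>

lemma profile_left:
  fixes a c eta D :: real and r :: nat
  assumes a: "1 \<le> a" and c: "2 \<le> c" and K: "K = c powr (a / (a + 2))"
    and eta: "0 < eta" "eta \<le> D / K\<^sup>2" and D: "1 \<le> D"
    and r: "(real r / c) powr a \<le> 1 + eta" "1 + eta < (real (r + 1) / c) powr a"
    and large: "6 * D \<le> K" "2 \<le> c powr (2 / (a + 2))"
  shows "profile (\<lambda>j. 2 + 2 * eta - 2 * (real j / c) powr a) r c K a (1 / (2 * D)) (2 * D) (1 / 2)"
proof
  have cK: "K * c powr (2 / (a + 2)) = c"
  proof -
    have "K * c powr (2 / (a + 2)) = c powr (a / (a + 2) + 2 / (a + 2))" by (simp add: K powr_add)
    also have "a / (a + 2) + 2 / (a + 2) = 1" using a by (simp add: add_divide_distrib[symmetric])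
    finally show ?thesis using c by simp
  qed
  have K1: "1 \<le> K" using large D by simp
  have Ka: "(K / c) powr a = 1 / K\<^sup>2"
  proof -
    have "K / c = 1 / c powr (2 / (a + 2))" using cK K1 c by (simp add: field_simps)
    then have "(K / c) powr a = 1 / c powr (2 / (a + 2) * a)"
      by (simp add: powr_divide powr_powr)
    also have "2 / (a + 2) * a = a / (a + 2) * 2" by simp
    also have "c powr (a / (a + 2) * 2) = K\<^sup>2"
      unfolding K powr_powr[symmetric] using c by simp
    finally show ?thesis .
  qed
  show "1 \<le> a" "1 \<le> c" "K = c powr (a / (a + 2))" using a c K by auto
  show "0 < 1 / (2 * D)" "1 / (2 * D) \<le> 1" "1 \<le> 2 * D" "0 < (1 :: real) / 2" "(1 :: real) / 2 \<le> 1"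
    using D by auto
  show "2 + 2 * eta - 2 * (real (i + 1) / c) powr a \<le> 2 + 2 * eta - 2 * (real i / c) powr a" for i
    using a c by (simp add: powr_mono2 divide_right_mono)
  show "0 \<le> 2 + 2 * eta - 2 * (real r / c) powr a" using r by simp
  have "2 * eta \<le> 2 * D / K\<^sup>2" using eta by simp
  then show "2 + 2 * eta - 2 * (real 1 / c) powr a \<le> 2 + 2 * D / K\<^sup>2"
    using powr_ge_zero[of "real 1 / c" a] by linarith
  show "1 / (2 * D) * (real i / c) powr a \<le> max (2 - (2 + 2 * eta - 2 * (real i / c) powr a)) (1 / K\<^sup>2)" for i
  proof (cases "2 * eta \<le> (real i / c) powr a")
    case True
    have "1 / (2 * D) * (real i / c) powr a \<le> 1 * (real i / c) powr a"
      using D by (intro mult_right_mono) auto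
    with True show ?thesis by simp
  next
    case False
    then have "(real i / c) powr a \<le> 2 * D / K\<^sup>2" using \<open>2 * eta \<le> 2 * D / K\<^sup>2\<close> by linarith
    then have "1 / (2 * D) * (real i / c) powr a \<le> 1 / (2 * D) * (2 * D / K\<^sup>2)"
      using D by (intro mult_left_mono) auto
    also have "\<dots> = 1 / K\<^sup>2" using D by simp
    finally show ?thesis by simp
  qed
  show "2 - (2 + 2 * eta - 2 * (real i / c) powr a) \<le> 2 * D / K\<^sup>2" if "real i \<le> K" for i
  proof -
    have "(real i / c) powr a \<le> (K / c) powr a"
      using that a c by (intro powr_mono2 divide_right_mono) auto
    then have "2 - (2 + 2 * eta - 2 * (real i / c) powr a) \<le> 2 * (1 / K\<^sup>2)" using eta Ka by simp
    also have "\<dots> \<le> 2 * D / K\<^sup>2" using D by (simp add: divide_right_mono)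
    finally show ?thesis .
  qed
  have "c \<le> real (r + 1)"
  proof (rule ccontr)
    assume "\<not> c \<le> real (r + 1)"
    then have "(real (r + 1) / c) powr a \<le> 1" using a c by (intro powr_le1) auto
    then show False using r eta by linarith
  qed
  then show "1 / 2 * c \<le> real r" using c by simp
  show "3 * (2 * D) \<le> K" using large by simp
  have "K * 2 \<le> c" using cK mult_left_mono[OF large(2), of K] K1 by linarith
  then show "K \<le> 1 / 2 * c" by simp
qed

text \<open>Near t = 2^(1/a) c, where (t / c)^a = 2, the coefficients -B_j pass 2 linearly in j;
  hence al = 1 and K = c^(1/3). In C, 8 a m pays for the overshoot of n beyond t, 2 D for eta and 8
  a for the slope. As eta <= 1/2, r is at most (3/2)^(1/a) c, which gives nu.\<close>

lemma profile_right:
  fixes a c eta D m :: real and r n :: nat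
  assumes a: "1 \<le> a" and c: "2 \<le> c" and K: "K = c powr (1 / 3)"
    and eta: "0 < eta" "eta \<le> D / K\<^sup>2" "eta \<le> 1 / 2" and D: "1 \<le> D"
    and r: "r < n" "(real r / c) powr a \<le> 1 + eta" "1 + eta < (real (r + 1) / c) powr a"
    and n: "2 powr (1 / a) * c < real n" "real n < 2 powr (1 / a) * c + m * K" "1 \<le> m"
    and large: "3 * (8 * a * m + 2 * D + 8 * a) \<le> K"
      "1 / (2 powr (1 / a) - (3 / 2) powr (1 / a)) \<le> K\<^sup>2" "a * m \<le> K\<^sup>2" "2 \<le> K\<^sup>2"
  shows "profile (\<lambda>j. - (2 + 2 * eta - 2 * (real (n + 1 - j) / c) powr a)) (n - r) c K 1
    (1 / (2 * (m + 1))) (8 * a * m + 2 * D + 8 * a) (2 powr (1 / a) - (3 / 2) powr (1 / a))"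
proof
  define t where "t = 2 powr (1 / a) * c"
  have cK: "c = K ^ 3"
  proof -
    have "K ^ 3 = (c powr (1 / 3)) powr 3" using c by (simp add: K)
    also have "\<dots> = c" using c by (simp add: powr_powr)
    finally show ?thesis by simp
  qed
  have K1: "1 \<le> K"
  proof -
    have "0 \<le> 8 * a * m" using a n by simp
    then have "1 \<le> 8 * a * m + 2 * D + 8 * a" using D a by linarith
    then show ?thesis using large(1) by argo
  qed
  have Kc: "K / c = 1 / K\<^sup>2" using K1 by (simp add: cK power2_eq_square power3_eq_cube)
  have two: "1 \<le> 2 powr (1 / a)" "2 powr (1 / a) \<le> 2" "1 \<le> (3 / 2) powr (1 / a)"
  proof -
    show "1 \<le> 2 powr (1 / a)" "1 \<le> (3 / 2) powr (1 / a)" using a by (auto intro: ge_one_powr_ge_zero)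
    have "2 powr (1 / a) \<le> 2 powr 1" using a by (intro powr_mono) auto
    then show "2 powr (1 / a) \<le> 2" by simp
  qed
  have t: "c \<le> t" "t \<le> 2 * c" "0 < t" using two c by (auto simp: t_def)
  have ta: "(s * t / c) powr a = 2 * s powr a" if "0 \<le> s" for s
  proof -
    have "s * t / c = s * 2 powr (1 / a)" using c by (simp add: t_def)
    then show ?thesis using a that by (simp add: powr_mult powr_powr)
  qed
  show "1 \<le> (1 :: real)" "1 \<le> c" "K = c powr (1 / (1 + 2))" using c K by auto
  show "0 < 1 / (2 * (m + 1))" "1 / (2 * (m + 1)) \<le> 1" using n by auto
  have "0 \<le> 8 * a * m" using a n by simp
  then show "1 \<le> 8 * a * m + 2 * D + 8 * a" using D a by linarith
  have "(3 / 2) powr (1 / a) < 2 powr (1 / a)" using a by (intro powr_less_mono2) auto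
  then show nu0: "0 < 2 powr (1 / a) - (3 / 2) powr (1 / a)" by simp
  show "2 powr (1 / a) - (3 / 2) powr (1 / a) \<le> 1" using two by linarith
  show "- (2 + 2 * eta - 2 * (real (n + 1 - (i + 1)) / c) powr a)
      \<le> - (2 + 2 * eta - 2 * (real (n + 1 - i) / c) powr a)" for i
    using a c by (auto intro!: powr_mono2 divide_right_mono)
  have "n + 1 - (n - r) = r + 1" using r by simp
  then show "0 \<le> - (2 + 2 * eta - 2 * (real (n + 1 - (n - r)) / c) powr a)" using r by simp
  have mK: "m * K / t \<le> m / K\<^sup>2" "0 \<le> m * K / t"
  proof -
    have "m * K / t \<le> m * K / c" using t n K1 c by (intro divide_left_mono) auto
    also have "\<dots> = m * (K / c)" by simp
    finally show "m * K / t \<le> m / K\<^sup>2" by (simp add: Kc)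
    show "0 \<le> m * K / t" using t n K1 by simp
  qed
  show "- (2 + 2 * eta - 2 * (real (n + 1 - 1) / c) powr a) \<le> 2 + (8 * a * m + 2 * D + 8 * a) / K\<^sup>2"
  proof -
    define z where "z = a * (m * K / t)"
    have z: "0 \<le> z" "z \<le> a * m / K\<^sup>2" "a * m / K\<^sup>2 \<le> 1"
      using mK a large K1 mult_left_mono[OF mK(1), of a] mult_nonneg_nonneg[OF _ mK(2), of a]
      by (auto simp: z_def)
    have "(real n / c) powr a \<le> ((1 + m * K / t) * t / c) powr a"
      using n a c t by (intro powr_mono2 divide_right_mono) (auto simp: t_def[symmetric] distrib_right)
    also have "\<dots> = 2 * (1 + m * K / t) powr a" using mK by (intro ta) auto
    also have "\<dots> \<le> 2 * exp (m * K / t) powr a"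
      using mK a by (intro mult_left_mono powr_mono2) auto
    also have "\<dots> = 2 * exp z" by (simp add: z_def powr_def)
    also have "exp z \<le> 1 + z + z\<^sup>2" using z by (intro exp_bound) auto
    also have "z\<^sup>2 \<le> z" using z mult_left_mono[of z 1 z] by (simp add: power2_eq_square)
    finally have "(real n / c) powr a \<le> 2 + 4 * (a * m / K\<^sup>2)" using z by simp
    moreover have "(8 * a * m) / K\<^sup>2 \<le> (8 * a * m + 2 * D + 8 * a) / K\<^sup>2"
      using D a K1 by (intro divide_right_mono) auto
    ultimately show ?thesis using eta by simp
  qed
  show "1 / (2 * (m + 1)) * (real i / c) powr 1
      \<le> max (2 - - (2 + 2 * eta - 2 * (real (n + 1 - i) / c) powr a)) (1 / K\<^sup>2)" if i: "1 \<le> i" "i \<le> n - r" for i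
  \<comment> \<open>Below this threshold the alternative 1 / K^2 suffices; above it, half of i
    outweighs the overshoot of n + 1 over t, at most (m + 1) K.\<close>
  proof (cases "real i < 2 * (m + 1) * K")
    case True
    then have "real i / c \<le> 2 * (m + 1) * K / c" using c by (intro divide_right_mono) auto
    also have "\<dots> = 2 * (m + 1) * (K / c)" by simp
    also have "\<dots> = 2 * (m + 1) / K\<^sup>2" by (simp add: Kc)
    finally have "1 / (2 * (m + 1)) * (real i / c) \<le> 1 / (2 * (m + 1)) * (2 * (m + 1) / K\<^sup>2)"
      using n by (intro mult_left_mono) auto
    then show ?thesis using n c by simp
  next
    case False
    define s where "s = real i / (2 * t)"
    have nat: "real (n + 1 - i) = real n + 1 - real i" "0 < real (n + 1 - i)" using i by auto
    have "real (n + 1 - i) \<le> t + (m + 1) * K - real i"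
    proof -
      have "real n < t + m * K" using n by (simp add: t_def)
      moreover have "(m + 1) * K = m * K + K" by (simp add: distrib_right)
      ultimately show ?thesis using nat K1 by linarith
    qed
    also have "\<dots> \<le> t - real i / 2"
    proof -
      have "2 * ((m + 1) * K) \<le> real i" using False unfolding not_less mult.assoc .
      then show ?thesis by linarith
    qed
    also have "\<dots> = (1 - s) * t" using t by (simp add: s_def field_simps)
    finally have le: "real (n + 1 - i) \<le> (1 - s) * t" .
    then have s: "0 < 1 - s" using nat t by (metis less_le_trans zero_less_mult_pos2)
    have s0: "0 \<le> s" using t by (simp add: s_def)
    have "(real (n + 1 - i) / c) powr a \<le> ((1 - s) * t / c) powr a"
      using le a c by (intro powr_mono2 divide_right_mono) auto
    also have "\<dots> = 2 * (1 - s) powr a" using s by (intro ta) auto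
    also have "(1 - s) powr a \<le> 1 - s" using s s0 a by (intro powr_le_one_le) auto
    finally have "4 * s \<le> 2 - - (2 + 2 * eta - 2 * (real (n + 1 - i) / c) powr a)" using eta by simp
    moreover have "real i / c \<le> 4 * s"
    proof -
      have "2 * real i / (2 * c) \<le> 2 * real i / t" using t c by (intro divide_left_mono) auto
      then show ?thesis by (simp add: s_def)
    qed
    moreover have "1 / (2 * (m + 1)) * (real i / c) powr 1 \<le> 1 * (real i / c)"
      by (rule mult_mono) (use n c in auto)
    ultimately show ?thesis by simp
  qed
  show "2 - - (2 + 2 * eta - 2 * (real (n + 1 - i) / c) powr a) \<le> (8 * a * m + 2 * D + 8 * a) / K\<^sup>2"
    if i: "1 \<le> i" "i \<le> n - r" "real i \<le> K" for i
  proof -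
    define s where "s = real i / t"
    have "s \<le> K / c" unfolding s_def using i t c K1 by (intro frac_le) auto
    then have sK: "s \<le> 1 / K\<^sup>2" by (simp add: Kc)
    also have "\<dots> \<le> 1 / 2" using large K1 by (intro divide_left_mono) auto
    finally have s12: "s \<le> 1 / 2" .
    have s0: "0 \<le> s" using t by (simp add: s_def)
    have "(1 - s) * t \<le> real (n + 1 - i)"
      using i n t by (simp add: s_def t_def[symmetric] left_diff_distrib)
    then have "((1 - s) * t / c) powr a \<le> (real (n + 1 - i) / c) powr a"
      using s12 t a c by (intro powr_mono2 divide_right_mono) auto
    then have 1: "2 * (1 - s) powr a \<le> (real (n + 1 - i) / c) powr a"
      using s12 by (simp add: ta)
    \<comment> \<open>For s <= 1/2 this gives ln (1 - s) >= -2 s, and then the Bernoulli-type bound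
      (1 - s)^a >= 1 - 2 a s.\<close>
    have "- s - 2 * s\<^sup>2 \<le> ln (1 - s)" using s0 s12 by (rule ln_one_minus_pos_lower_bound)
    moreover have "2 * s\<^sup>2 \<le> s" using mult_left_mono[OF s12 s0] by (simp add: power2_eq_square)
    ultimately have "a * (- 2 * s) \<le> a * ln (1 - s)" using a by (intro mult_left_mono) auto
    then have "exp (a * (- 2 * s)) \<le> (1 - s) powr a" using s12 by (simp add: powr_def)
    moreover have "1 + a * (- 2 * s) \<le> exp (a * (- 2 * s))" by (rule exp_ge_add_one_self)
    ultimately have "1 - 2 * (a * s) \<le> (1 - s) powr a" by simp
    then have "2 - - (2 + 2 * eta - 2 * (real (n + 1 - i) / c) powr a) \<le> 2 * eta + 8 * (a * s)"
      using 1 by simp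
    also have "\<dots> \<le> 2 * (D / K\<^sup>2) + 8 * (a * (1 / K\<^sup>2))"
      using eta sK a by (intro add_mono mult_left_mono) auto
    also have "\<dots> = (2 * D + 8 * a) / K\<^sup>2" by (simp add: add_divide_distrib)
    also have "\<dots> \<le> (8 * a * m + 2 * D + 8 * a) / K\<^sup>2"
      using a n by (intro divide_right_mono) auto
    finally show ?thesis .
  qed
  show "(2 powr (1 / a) - (3 / 2) powr (1 / a)) * c \<le> real (n - r)"
  proof -
    have "((real r / c) powr a) powr (1 / a) \<le> (3 / 2) powr (1 / a)"
      using r eta a by (intro powr_mono2) auto
    then have "real r / c \<le> (3 / 2) powr (1 / a)" using a c by (simp add: powr_powr)
    then have "real r \<le> (3 / 2) powr (1 / a) * c" using c by (simp add: field_simps)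
    then show ?thesis using n r by (simp add: left_diff_distrib)
  qed
  show "3 * (8 * a * m + 2 * D + 8 * a) \<le> K" by (rule large)
  have "1 \<le> (2 powr (1 / a) - (3 / 2) powr (1 / a)) * K\<^sup>2"
    using large(2) nu0 by (simp add: field_simps)
  then have "1 * K \<le> (2 powr (1 / a) - (3 / 2) powr (1 / a)) * K\<^sup>2 * K"
    using K1 by (intro mult_right_mono) auto
  then show "K \<le> (2 powr (1 / a) - (3 / 2) powr (1 / a)) * c"
    by (simp add: cK power2_eq_square power3_eq_cube mult.assoc)
qed


section \<open>Conclusion for large c\<close>

lemma eventually_ge_powr:
  fixes p z :: real
  assumes "0 < p" shows "\<forall>\<^sub>F c in at_top. z \<le> c powr p"
proof -
  have "filterlim (\<lambda>c :: real. c powr p) at_top at_top" using assms by real_asymp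
  then show ?thesis by (simp add: filterlim_at_top)
qed

text \<open>The gap between K^(7/2) and K^4 is K^(1/2) = c^(a / (2 a + 4)), whose exponent is at
  least 1/6 for a >= 1.\<close>

lemma eventually_log_le_powr:
  fixes Z k0 :: real
  assumes "0 < k0"
  shows "\<forall>\<^sub>F c in at_top. Z * (1 + ln (3 * c))\<^sup>2 \<le> k0 * c powr (1 / 6)"
proof -
  have "((\<lambda>c :: real. Z * ((1 + ln (3 * c))\<^sup>2 / c powr (1 / 6))) \<longlongrightarrow> Z * 0) at_top"
    by (intro tendsto_mult tendsto_const) real_asymp
  then have "\<forall>\<^sub>F c in at_top. Z * ((1 + ln (3 * c))\<^sup>2 / c powr (1 / 6)) < k0"
    using assms by (intro order_tendstoD) auto
  then show ?thesis
    using eventually_gt_at_top[of 0]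
  proof eventually_elim
    case (elim c)
    then show ?case by (simp add: field_simps less_imp_le)
  qed
qed

lemma split_index_eqI:
  assumes a: "1 \<le> a" and c: "0 < c" and eta: "0 < eta"
    and r: "1 \<le> r" "r < n" "(real r / c) powr a \<le> 1 + eta" "1 + eta < (real (r + 1) / c) powr a"
  shows "split_index a c n (4 + 2 * eta) = r"
  unfolding split_index_def
proof (rule the_equality)
  show "1 \<le> r \<and> r < n \<and> diag_entry a c r \<le> 4 + 2 * eta \<and> 4 + 2 * eta < diag_entry a c (r + 1)"
    using r by (simp add: diag_entry_def)
next
  fix s assume "1 \<le> s \<and> s < n \<and> diag_entry a c s \<le> 4 + 2 * eta \<and> 4 + 2 * eta < diag_entry a c (s + 1)"
  then have s: "(real s / c) powr a \<le> 1 + eta" "1 + eta < (real (s + 1) / c) powr a"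
    by (auto simp: diag_entry_def)
  have less: "i < j + 1" if "(real i / c) powr a < (real (j + 1) / c) powr a" for i j
  proof (rule ccontr)
    assume "\<not> i < j + 1"
    then have "(real (j + 1) / c) powr a \<le> (real i / c) powr a"
      using a c by (intro powr_mono2 divide_right_mono) auto
    then show False using that by simp
  qed
  have "s < r + 1" "r < s + 1"
    using less[OF le_less_trans[OF s(1) r(4)]] less[OF le_less_trans[OF r(3) s(2)]] by auto
  then show "s = r" by simp
qed


text \<open>D bounds eta K^2 and m bounds the overshoot of n in units of c^(1/3). With both fixed, Z
  is independent of c, which then enters the error bound only through the power of K and the
  logarithm.\<close>

lemma computed_first_component:
  fixes a c eps eta D m K K3 :: real and n :: nat
  assumes a: "1 \<le> a" and eps: "0 \<le> eps" and D: "1 \<le> D" and m: "1 \<le> m" and c: "2 \<le> c"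
    and K: "K = c powr (a / (a + 2))" and K3: "K3 = c powr (1 / 3)"
    and eta: "0 < eta" "eta * K\<^sup>2 \<le> D"
    and n: "2 powr (1 / a) * c < real n" "real n < 2 powr (1 / a) * c + m * K3"
    and X: "eigenvector (tridiag_mat a c n) X (4 + 2 * eta)"
    and large: "6 * D \<le> K" "2 \<le> c powr (2 / (a + 2))" "2 * D \<le> K\<^sup>2"
      "3 * (8 * a * m + 2 * D + 8 * a) \<le> K3"
      "1 / (2 powr (1 / a) - (3 / 2) powr (1 / a)) \<le> K3\<^sup>2" "a * m \<le> K3\<^sup>2" "2 \<le> K3\<^sup>2"
  defines "Z \<equiv> profile.cond a (1 / (2 * D)) (2 * D) (1 / 2) + 2 * profile.cond 1 (1 / (2 * (m + 1)))
      (8 * a * m + 2 * D + 8 * a) (2 powr (1 / a) - (3 / 2) powr (1 / a))"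
  shows "rel_computed eps a c n (4 + 2 * eta) 1 \<le> eps * (Z * (K powr (7 / 2) * (1 + ln (3 * c))\<^sup>2))"
    and "(vec_index X 0)\<^sup>2 * K ^ 3 \<le> 2592 * (2 * D) ^ 3 * scalar_prod X X"
proof -
  \<comment> \<open>The diagonal reaches lambda at the real index c (1 + eta)^(1/a).\<close>
  define r where "r = nat \<lfloor>c * (1 + eta) powr (1 / a)\<rfloor>"
  define B where "B = (\<lambda>j. 2 + 2 * eta - 2 * (real j / c) powr a)"
  have Bd: "B = (\<lambda>j. 4 + 2 * eta - diag_entry a c j)" by (auto simp: B_def diag_entry_def)
  have K1: "1 \<le> K" using large D by linarith
  have K31: "1 \<le> K3" using c by (simp add: K3 ge_one_powr_ge_zero)
  \<comment> \<open>As a >= 1, the scale on the right is the smaller one, so both contributions fit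
    under the same power of K.\<close>
  have K3K: "K3 \<le> K" unfolding K K3 using a c by (intro powr_mono) (auto simp: field_simps)
  have etaD: "eta \<le> D / K\<^sup>2" using eta K1 by (simp add: pos_le_divide_eq)
  also have "\<dots> \<le> D / K3\<^sup>2" using D K3K K31 by (intro divide_left_mono power_mono) auto
  finally have etaD3: "eta \<le> D / K3\<^sup>2" .
  have "D / K\<^sup>2 \<le> 1 / 2" using large K1 D by (simp add: field_simps)
  then have eta2: "eta \<le> 1 / 2" using etaD by linarith
  have pa: "((1 + eta) powr (1 / a)) powr a = 1 + eta" using a eta by (simp add: powr_powr)
  have g1: "1 \<le> (1 + eta) powr (1 / a)" using a eta by (intro ge_one_powr_ge_zero) auto
  have cg: "1 \<le> c * (1 + eta) powr (1 / a)" using g1 c mult_mono[of 1 c 1 "(1 + eta) powr (1 / a)"] by simp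
  have rr: "real r \<le> c * (1 + eta) powr (1 / a)" "c * (1 + eta) powr (1 / a) < real (r + 1)"
    unfolding r_def using cg by (auto simp: le_floor_iff) linarith
  have r1: "1 \<le> r" unfolding r_def using cg by (simp add: le_nat_iff le_floor_iff)
  have ra: "(real r / c) powr a \<le> 1 + eta" "1 + eta < (real (r + 1) / c) powr a"
  proof -
    have "(real r / c) powr a \<le> ((1 + eta) powr (1 / a)) powr a"
      using rr c a by (intro powr_mono2) (auto simp: field_simps)
    then show "(real r / c) powr a \<le> 1 + eta" by (simp add: pa)
    have "((1 + eta) powr (1 / a)) powr a < (real (r + 1) / c) powr a"
      using rr c a by (intro powr_less_mono2) (auto simp: field_simps)
    then show "1 + eta < (real (r + 1) / c) powr a" by (simp add: pa)
  qed
  have "(1 + eta) powr (1 / a) \<le> 2 powr (1 / a)" using a eta eta2 by (intro powr_mono2) auto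
  then have "c * (1 + eta) powr (1 / a) \<le> 2 powr (1 / a) * c" using c by (simp add: mult.commute)
  then have rn: "r < n" using rr n by linarith
  have split: "split_index a c n (4 + 2 * eta) = r"
    using a c eta r1 rn ra by (intro split_index_eqI) auto
  interpret L: profile B r c K a "1 / (2 * D)" "2 * D" "1 / 2"
    unfolding B_def using a c K eta etaD D ra large by (intro profile_left) auto
  interpret R: profile "\<lambda>j. - B (n + 1 - j)" "n - r" c K3 1 "1 / (2 * (m + 1))"
      "8 * a * m + 2 * D + 8 * a" "2 powr (1 / a) - (3 / 2) powr (1 / a)"
    unfolding B_def by (rule profile_right[OF a c K3 eta(1) etaD3 eta2 D rn ra n m large(4-7)])
  have n3: "real n \<le> 3 * c"
  proof -
    have "2 powr (1 / a) \<le> 2 powr 1" using a by (intro powr_mono) auto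
    then have "2 powr (1 / a) * c \<le> 2 * c" using c by (intro mult_right_mono) auto
    moreover have "m * K3 \<le> c"
    proof -
      have "1 * m \<le> a * m" using a m by (intro mult_right_mono) auto
      then have "m * K3 \<le> K3\<^sup>2 * K3" using large(6) K31 by (intro mult_right_mono) auto
      also have "K3\<^sup>2 * K3 = K3 ^ 3" by (simp add: power2_eq_square power3_eq_cube)
      also have "K3 ^ 3 = (c powr (1 / 3)) powr 3" using c by (simp add: K3)
      also have "\<dots> = c" using c by (simp add: powr_powr)
      finally show ?thesis .
    qed
    ultimately show ?thesis using n by linarith
  qed
  define V where "V = K powr (7 / 2) * (1 + ln (3 * c))\<^sup>2"
  have V0: "0 \<le> V" by (simp add: V_def)
  have LV: "K powr (7 / 2) * L.H\<^sup>2 \<le> V"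
  proof -
    have "L.H \<le> 1 + ln (3 * c)" unfolding L.H_def using L.N1 n3 rn c by (intro harmonic_sum_le) auto
    then show ?thesis unfolding V_def using L.H1 by (intro mult_left_mono power_mono) auto
  qed
  have RV: "K3 powr (7 / 2) * R.H\<^sup>2 \<le> V"
  proof -
    have "R.H \<le> 1 + ln (3 * c)" unfolding R.H_def using R.N1 n3 rn c by (intro harmonic_sum_le) auto
    then show ?thesis unfolding V_def using R.H1 K3K K31
      by (intro mult_mono power_mono powr_mono2) auto
  qed
  have glue: "left_seq B r * left_seq (\<lambda>k. B (n + 1 - k)) (n - r + 1)
      + left_seq B (r + 1) * left_seq (\<lambda>k. B (n + 1 - k)) (n - r) \<noteq> 0"
    unfolding Bd using L.Q_pos[unfolded L.Q_def] r1 rn unfolding Bd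
    by (intro tridiag_eigenvector_glue(2)[OF X]) auto
  have "rel_err eps n (\<lambda>d. computed_vec n r (\<lambda>j. B j * (1 + d j)) 1)
      \<le> eps * (L.cond * K powr (7 / 2) * L.H\<^sup>2 + 2 * (R.cond * K3 powr (7 / 2) * R.H\<^sup>2))"
  proof (rule rel_err_glued[OF eps r1 rn glue])
    show "(\<Sum>j=1..r. \<Sum>m=1..r + 1. 2 * \<bar>left_seq B m * resonance B j m\<bar>)
        \<le> L.cond * K powr (7 / 2) * L.H\<^sup>2 * (\<Sum>m=1..r + 1. (left_seq B m)\<^sup>2)"
      using L.sum_sensitivity_P by (simp only: L.P_def)
    show "(\<Sum>j=1..r. 2 * \<bar>left_seq B r * resonance B j r\<bar> + 2 * \<bar>left_seq B (r + 1) * resonance B j (r + 1)\<bar>)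
        \<le> L.cond * K powr (7 / 2) * L.H\<^sup>2 * ((left_seq B r)\<^sup>2 + (left_seq B (r + 1))\<^sup>2)"
      using L.sum_sensitivity_Q by (simp only: L.Q_def)
    show "(\<Sum>j=1..n - r. \<Sum>m=1..n - r + 1.
          2 * \<bar>left_seq (\<lambda>k. B (n + 1 - k)) m * resonance (\<lambda>k. B (n + 1 - k)) j m\<bar>)
        \<le> R.cond * K3 powr (7 / 2) * R.H\<^sup>2 * (\<Sum>m=1..n - r + 1. (left_seq (\<lambda>k. B (n + 1 - k)) m)\<^sup>2)"
      using R.sum_sensitivity_P by (simp only: R.P_def abs_left_seq_resonance_uminus left_seq_uminus_sq)
    show "(\<Sum>j=1..n - r. 2 * \<bar>left_seq (\<lambda>k. B (n + 1 - k)) (n - r) * resonance (\<lambda>k. B (n + 1 - k)) j (n - r)\<bar>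
          + 2 * \<bar>left_seq (\<lambda>k. B (n + 1 - k)) (n - r + 1) * resonance (\<lambda>k. B (n + 1 - k)) j (n - r + 1)\<bar>)
        \<le> R.cond * K3 powr (7 / 2) * R.H\<^sup>2 *
          ((left_seq (\<lambda>k. B (n + 1 - k)) (n - r))\<^sup>2 + (left_seq (\<lambda>k. B (n + 1 - k)) (n - r + 1))\<^sup>2)"
      using R.sum_sensitivity_Q by (simp only: R.Q_def abs_left_seq_resonance_uminus left_seq_uminus_sq)
  qed (use L.cond_pos R.cond_pos in \<open>auto simp: less_imp_le\<close>)
  also have "\<dots> \<le> eps * (L.cond * V + 2 * (R.cond * V))"
  proof -
    have "L.cond * K powr (7 / 2) * L.H\<^sup>2 \<le> L.cond * V"
      using mult_left_mono[OF LV less_imp_le[OF L.cond_pos]] by (simp only: mult.assoc)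
    moreover have "R.cond * K3 powr (7 / 2) * R.H\<^sup>2 \<le> R.cond * V"
      using mult_left_mono[OF RV less_imp_le[OF R.cond_pos]] by (simp only: mult.assoc)
    ultimately show ?thesis using eps by (intro mult_left_mono add_mono) auto
  qed
  also have "\<dots> = eps * (Z * V)" by (simp add: Z_def algebra_simps)
  finally show "rel_computed eps a c n (4 + 2 * eta) 1 \<le> eps * (Z * (K powr (7 / 2) * (1 + ln (3 * c))\<^sup>2))"
    by (simp add: rel_computed_def split V_def Bd)
  \<comment> \<open>The eigenvector is X_1 times x on all of 1, ..., n, and \<open>L.P\<close>
    collects only part of the squares.\<close>
  have "(vec_index X 0)\<^sup>2 * K ^ 3 \<le> (vec_index X 0)\<^sup>2 * (2592 * (2 * D) ^ 3 * L.P)"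
    by (intro mult_left_mono L.P_ge_cube) auto
  also have "\<dots> \<le> (vec_index X 0)\<^sup>2 * (2592 * (2 * D) ^ 3 * (\<Sum>j=1..n. (left_seq B j)\<^sup>2))"
    unfolding L.P_def using rn D by (intro mult_left_mono sum_mono2) auto
  also have "\<dots> = 2592 * (2 * D) ^ 3 * scalar_prod X X"
    unfolding tridiag_eigenvector_glue(1)[OF X] Bd by simp
  finally show "(vec_index X 0)\<^sup>2 * K ^ 3 \<le> 2592 * (2 * D) ^ 3 * scalar_prod X X" .
qed

theorem theorem19:
  fixes eps a dtil del :: real
    and n :: "real \<Rightarrow> nat"
    and lam dl :: "real \<Rightarrow> real"
    and X :: "real \<Rightarrow> real Matrix.vec"
  assumes "0 < eps" and "eps < 1"
    and "1 \<le> a"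
    and "1 \<le> dtil" and "dtil < del"
    and "\<And>c. 1 \<le> c \<Longrightarrow> 2 powr (1/a) * c < real (n c)"
    and "\<And>c. 1 \<le> c \<Longrightarrow> real (n c) < 2 powr (1/a) * c + mu eps a c + 1"
    and "\<And>c. 1 \<le> c \<Longrightarrow> eigenvalue (tridiag_mat a c (n c)) (lam c)"
    and "\<And>c. 1 \<le> c \<Longrightarrow> 1 < dtil \<and> dtil < dl c \<and> dl c < del"
    and "\<And>c. 1 \<le> c \<Longrightarrow> lam c = 4 + 2 * (dl c / c) powr (2*a / (a + 2))"
    and "\<And>c. 1 \<le> c \<Longrightarrow> eigenvector (tridiag_mat a c (n c)) (X c) (lam c)"
    and "\<And>c. 1 \<le> c \<Longrightarrow> sqrt (scalar_prod (X c) (X c)) = 1"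
  shows "(\<exists>g. g \<in> o[at_top](\<lambda>_. 1 :: real) \<and>
            (\<forall>\<^sub>F c in at_top. \<bar>vec_index (X c) 0\<bar> < exp (- dtil * D_const a) * (1 + g c)))
       \<and> (a > 1 \<longrightarrow>
          (\<exists>g. g \<in> o[at_top](\<lambda>_. 1 :: real) \<and>
            (\<forall>\<^sub>F c in at_top. rel_computed eps a c (n c) (lam c) 1
               \<le> 620 * del powr ((16 - 4*a) / (3*a + 6)) * c powr (4*a / (a + 2)) * eps * (1 + g c))))
       \<and> (a = 1 \<longrightarrow>
          (\<exists>g. g \<in> o[at_top](\<lambda>_. 1 :: real) \<and>
            (\<forall>\<^sub>F c in at_top. rel_computed eps a c (n c) (lam c) 1
               \<le> 960 * (del powr (4/3) / 4 + (- ln eps) powr (4/3) + 1)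
                   * c powr (4/3) * eps * (1 + g c))))"
proof -
  note a = assms(3)
  \<comment> \<open>Bounds eta K^2, which equals delta(c)^(2a/(a+2)).\<close>
  define D where "D = del powr (2 * a / (a + 2))"
  \<comment> \<open>mu(c) = (m - 1) c^(1/3); the added 1 pays for the + 1 in the bound on n, as
    c^(1/3) >= 1.\<close>
  define m where "m = (2 powr (1 / a) / a) powr (1 / 3) * (- (3 / 4) * ln eps) powr (2 / 3) + 1"
  define nu where "nu = 2 powr (1 / a) - (3 / 2) powr (1 / a)"
  define Z where "Z = profile.cond a (1 / (2 * D)) (2 * D) (1 / 2) + 2 * profile.cond 1 (1 / (2 * (m + 1)))
      (8 * a * m + 2 * D + 8 * a) nu"
  define K where "K = (\<lambda>c. c powr (a / (a + 2)))"
  have D1: "1 \<le> D" unfolding D_def using assms by (intro ge_one_powr_ge_zero) auto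
  have m1: "1 \<le> m" by (simp add: m_def)
  have large: "\<forall>\<^sub>F c in at_top. 2 \<le> c \<and> 6 * D \<le> c powr (a / (a + 2)) \<and> 2 \<le> c powr (2 / (a + 2)) \<and>
      2 * D \<le> c powr (2 * a / (a + 2)) \<and> 3 * (8 * a * m + 2 * D + 8 * a) \<le> c powr (1 / 3) \<and>
      1 / nu \<le> c powr (2 / 3) \<and> a * m \<le> c powr (2 / 3) \<and> 2 \<le> c powr (2 / 3)"
    using a by (intro eventually_conj eventually_ge_powr eventually_ge_at_top) auto
  have main: "\<forall>\<^sub>F c in at_top.
      rel_computed eps a c (n c) (lam c) 1 \<le> eps * (Z * (K c powr (7 / 2) * (1 + ln (3 * c))\<^sup>2)) \<and>
      (vec_index (X c) 0)\<^sup>2 * K c ^ 3 \<le> 2592 * (2 * D) ^ 3"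
    using large
  proof eventually_elim
    case (elim c)
    then have c: "2 \<le> c" "1 \<le> c" "0 < c" by auto
    define eta where "eta = (dl c / c) powr (2 * a / (a + 2))"
    have dl: "1 < dl c" "dl c < del" using assms(4) assms(9)[OF c(2)] by auto
    have lam: "lam c = 4 + 2 * eta" using assms(10)[OF c(2)] by (simp add: eta_def)
    have K2: "(K c)\<^sup>2 = c powr (2 * a / (a + 2))"
    proof -
      have "(K c)\<^sup>2 = (c powr (a / (a + 2))) powr 2" using c by (simp add: K_def)
      then show ?thesis by (simp add: powr_powr mult.commute)
    qed
    have K32: "(c powr (1 / 3))\<^sup>2 = c powr (2 / 3)"
    proof -
      have "(c powr (1 / 3))\<^sup>2 = (c powr (1 / 3)) powr 2" using c by simp
      then show ?thesis by (simp add: powr_powr)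
    qed
    have eta0: "0 < eta" using dl c by (simp add: eta_def)
    have "eta * (K c)\<^sup>2 = dl c powr (2 * a / (a + 2))"
      using dl c by (simp add: eta_def K2 powr_divide)
    also have "\<dots> \<le> D" unfolding D_def using dl a by (intro powr_mono2) auto
    finally have etaD: "eta * (K c)\<^sup>2 \<le> D" .
    have "mu eps a c + 1 \<le> m * c powr (1 / 3)"
    proof -
      have "(2 powr (1 / a) * c / a) powr (1 / 3) = ((2 powr (1 / a) / a) * c) powr (1 / 3)" by simp
      also have "\<dots> = (2 powr (1 / a) / a) powr (1 / 3) * c powr (1 / 3)"
        using a c by (intro powr_mult)
      finally have "mu eps a c = (m - 1) * c powr (1 / 3)" by (simp add: mu_def m_def mult_ac)
      moreover have "1 \<le> c powr (1 / 3)" using c by (intro ge_one_powr_ge_zero) auto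
      ultimately show ?thesis by (simp add: left_diff_distrib)
    qed
    then have n: "real (n c) < 2 powr (1 / a) * c + m * c powr (1 / 3)"
      using assms(7)[OF c(2)] by linarith
    have X: "eigenvector (tridiag_mat a c (n c)) (X c) (4 + 2 * eta)"
      using assms(11)[OF c(2)] by (simp add: lam)
    have XX: "scalar_prod (X c) (X c) = 1" using assms(12)[OF c(2)] by simp
    have lg: "6 * D \<le> K c" "2 \<le> c powr (2 / (a + 2))" "2 * D \<le> (K c)\<^sup>2"
        "3 * (8 * a * m + 2 * D + 8 * a) \<le> c powr (1 / 3)"
        "1 / (2 powr (1 / a) - (3 / 2) powr (1 / a)) \<le> (c powr (1 / 3))\<^sup>2"
        "a * m \<le> (c powr (1 / 3))\<^sup>2" "2 \<le> (c powr (1 / 3))\<^sup>2"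
      unfolding K2 K32 using elim by (auto simp: K_def nu_def)
    note comp = computed_first_component[OF a less_imp_le[OF assms(1)] D1 m1 c(1)
        _ refl eta0 etaD assms(6)[OF c(2)] n X lg]
    have "rel_computed eps a c (n c) (4 + 2 * eta) 1
        \<le> eps * (Z * (K c powr (7 / 2) * (1 + ln (3 * c))\<^sup>2))"
      unfolding Z_def nu_def by (rule comp(1)) (simp add: K_def)
    moreover have "(vec_index (X c) 0)\<^sup>2 * K c ^ 3 \<le> 2592 * (2 * D) ^ 3 * scalar_prod (X c) (X c)"
      by (rule comp(2)) (simp add: K_def)
    ultimately show ?case by (simp add: lam XX)
  qed
  \<comment> \<open>Every k0 > 0 is admissible, so both explicit constants can be inserted later,
    with g = 0.\<close>
  have rel: "\<forall>\<^sub>F c in at_top. rel_computed eps a c (n c) (lam c) 1 \<le> k0 * c powr (4 * a / (a + 2)) * eps"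
    if k0: "0 < k0" for k0 :: real
    using main eventually_log_le_powr[OF k0, of Z] eventually_ge_at_top[of 1]
  proof eventually_elim
    case (elim c)
    have K1: "1 \<le> K c" unfolding K_def using elim a by (intro ge_one_powr_ge_zero) auto
    have "c powr (1 / 6) \<le> K c powr (1 / 2)"
      unfolding K_def powr_powr using elim a by (intro powr_mono) (auto simp: field_simps)
    then have "k0 * c powr (1 / 6) \<le> k0 * K c powr (1 / 2)" using k0 by simp
    then have "Z * (1 + ln (3 * c))\<^sup>2 \<le> k0 * K c powr (1 / 2)" using elim by linarith
    then have "K c powr (7 / 2) * (Z * (1 + ln (3 * c))\<^sup>2) \<le> K c powr (7 / 2) * (k0 * K c powr (1 / 2))"
      by (intro mult_left_mono) auto
    also have "\<dots> = k0 * (K c powr (7 / 2) * K c powr (1 / 2))" by simp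
    also have "K c powr (7 / 2) * K c powr (1 / 2) = K c powr 4" unfolding powr_add[symmetric] by simp
    also have "\<dots> = c powr (4 * a / (a + 2))" by (simp add: K_def powr_powr mult.commute)
    finally have "eps * (Z * (K c powr (7 / 2) * (1 + ln (3 * c))\<^sup>2)) \<le> eps * (k0 * c powr (4 * a / (a + 2)))"
      using assms(1) by (intro mult_left_mono) (auto simp: mult_ac)
    also have "\<dots> = k0 * c powr (4 * a / (a + 2)) * eps" by simp
    finally show ?case using elim by linarith
  qed
  have zero: "(\<lambda>_ :: real. 0 :: real) \<in> o[at_top](\<lambda>_. 1 :: real)" by simp
  have first: "\<forall>\<^sub>F c in at_top. \<bar>vec_index (X c) 0\<bar> < exp (- dtil * D_const a)"
  proof -
    define y where "y = exp (- dtil * D_const a)"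
    have y: "0 < y" by (simp add: y_def)
    \<comment> \<open>The summand 1 makes the final inequality strict.\<close>
    have "\<forall>\<^sub>F c in at_top. (2592 * (2 * D) ^ 3 + 1) / y\<^sup>2 \<le> c powr (a / (a + 2))"
      using a by (intro eventually_ge_powr) auto
    then have "\<forall>\<^sub>F c in at_top. \<bar>vec_index (X c) 0\<bar> < y"
      using main eventually_ge_at_top[of 1]
    proof eventually_elim
      case (elim c)
      have K1: "1 \<le> K c" unfolding K_def using elim a by (intro ge_one_powr_ge_zero) auto
      have "2592 * (2 * D) ^ 3 < y\<^sup>2 * K c" using elim(1) y by (simp add: K_def field_simps)
      also have "\<dots> \<le> y\<^sup>2 * K c ^ 3"
        using K1 power_increasing[of 1 3 "K c"] by (intro mult_left_mono) auto
      finally have "(vec_index (X c) 0)\<^sup>2 * K c ^ 3 < y\<^sup>2 * K c ^ 3" using elim by linarith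
      then have "(vec_index (X c) 0)\<^sup>2 < y\<^sup>2" using K1 by simp
      then show ?case using y abs_le_square_iff[of y "vec_index (X c) 0"] by (simp add: not_le[symmetric])
    qed
    then show ?thesis by (simp add: y_def)
  qed
  show ?thesis
  proof (intro conjI impI)
    show "\<exists>g. g \<in> o[at_top](\<lambda>_. 1 :: real) \<and>
        (\<forall>\<^sub>F c in at_top. \<bar>vec_index (X c) 0\<bar> < exp (- dtil * D_const a) * (1 + g c))"
      using zero first by (intro exI[of _ "\<lambda>_. 0"]) simp
    have "0 < 620 * del powr ((16 - 4*a) / (3*a + 6))" using assms by simp
    from rel[OF this] show "\<exists>g. g \<in> o[at_top](\<lambda>_. 1 :: real) \<and>
        (\<forall>\<^sub>F c in at_top. rel_computed eps a c (n c) (lam c) 1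
           \<le> 620 * del powr ((16 - 4*a) / (3*a + 6)) * c powr (4*a / (a + 2)) * eps * (1 + g c))"
      using zero by (intro exI[of _ "\<lambda>_. 0"]) simp
  next
    assume a1: "a = 1"
    have "0 < 960 * (del powr (4/3) / 4 + (- ln eps) powr (4/3) + 1)"
      by (intro mult_pos_pos add_nonneg_pos) auto
    from rel[OF this] show "\<exists>g. g \<in> o[at_top](\<lambda>_. 1 :: real) \<and>
        (\<forall>\<^sub>F c in at_top. rel_computed eps a c (n c) (lam c) 1
           \<le> 960 * (del powr (4/3) / 4 + (- ln eps) powr (4/3) + 1)
               * c powr (4/3) * eps * (1 + g c))"
      using zero a1 by (intro exI[of _ "\<lambda>_. 0"]) simp
  qed
qed

end
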